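(* Let $\Bbbk$ be a field of characteristic $0$ and let $\mathfrak{g}$ be an infinite-dimensional Lie subalgebra of $W_{\geq -1} = \operatorname{Der}(\Bbbk[t])$. The following are equivalent: (1) There exists a non-constant $f \in \Bbbk[t]$ such that $\mathfrak{g}$ is contained in $L(f)$ and has finite codimension in $L(f)$. (2) The set $R(\mathfrak{g})$ is a field (i.e. a subfield of $\Bbbk(t)$). (3) There exists a nonzero $f \in \Bbbk[t]$ such that $R(\mathfrak{g}) = \Bbbk(f)$.
   Context: $W_{\geq -1} = \operatorname{Der}(\Bbbk[t]) = \Bbbk[t]\partial$, where $\partial$ is differentiation with respect to $t$, with Lie bracket $[f\partial, g\partial] = (fg' - f'g)\partial$. For a Lie subalgebra $\mathfrak{g} \subseteq W_{\geq -1}$, the set of ratios is $R(\mathfrak{g}) = \{ \frac{w}{u} \in \Bbbk(t) \mid w\partial, u\partial \in \mathfrak{g},\ u \neq 0\}$. For a non-constant polynomial $f \in \Bbbk[t]$, let $g_f \in \Bbbk[t]\setminus\{0\}$ be a polynomial of minimal degree among all nonzero $g \in \Bbbk[t]$ with $f'g \in \Bbbk[f]$; such $g_f$ exists and is unique up to a nonzero scalar. Set $L(f) = \Bbbk[f]\, g_f\, \partial = \{p(f) g_f \partial \mid p \in \Bbbk[t]\}$, which is a Lie subalgebra of $W_{\geq -1}$. *)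

theory Defs
  imports
    "HOL-Algebra.Algebraic_Closure_Type"
    "HOL-Algebra.Generated_Fields"
    "HOL-Library.Function_Algebras"
begin

section \<open>The Lie algebra of derivations of the polynomial ring\<close>

definition endo_scale :: "'a::field \<Rightarrow> ('a poly \<Rightarrow> 'a poly) \<Rightarrow> 'a poly \<Rightarrow> 'a poly" where
  "endo_scale c D = (\<lambda>p. smult c (D p))"

text \<open>Addition of operators is pointwise, as in \<^theory>\<open>HOL-Library.Function_Algebras\<close>.\<close>

global_interpretation endo: vector_space "endo_scale :: 'a::field \<Rightarrow> _"
  by unfold_locales (simp_all add: endo_scale_def fun_eq_iff smult_add_left smult_add_right)

definition derivation :: "('a::field poly \<Rightarrow> 'a poly) \<Rightarrow> bool" where
  "derivation D \<longleftrightarrow> Vector_Spaces.linear smult smult D \<and> (\<forall>p q. D (p * q) = D p * q + p * D q)"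

definition lie_bracket ::
    "('a::field poly \<Rightarrow> 'a poly) \<Rightarrow> ('a poly \<Rightarrow> 'a poly) \<Rightarrow> 'a poly \<Rightarrow> 'a poly" where
  "lie_bracket D E = (\<lambda>p. D (E p) - E (D p))"

definition lie_subalgebra :: "('a::field poly \<Rightarrow> 'a poly) set \<Rightarrow> bool" where
  "lie_subalgebra \<gg> \<longleftrightarrow>
     \<gg> \<subseteq> {D. derivation D} \<and> endo.subspace \<gg> \<and> (\<forall>D\<in>\<gg>. \<forall>E\<in>\<gg>. lie_bracket D E \<in> \<gg>)"

definition vfield :: "'a::field poly \<Rightarrow> 'a poly \<Rightarrow> 'a poly"  (\<open>_ \<partial>\<close> [1000] 1000) where
  "w \<partial> = (\<lambda>p. w * pderiv p)"

lemma smult_vector_space: "vector_space (smult :: 'a::field \<Rightarrow> _)"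
  by unfold_locales (simp_all add: smult_add_left smult_add_right)

lemma derivation_vfield: "derivation (w \<partial>)"
proof -
  have "Vector_Spaces.linear smult smult (w \<partial>)"
    by (simp add: Vector_Spaces.linear_iff smult_vector_space vfield_def pderiv_add pderiv_smult
        distrib_left)
  then show ?thesis
    by (simp add: derivation_def vfield_def pderiv_mult algebra_simps)
qed

lemma derivation_iff: "derivation D \<longleftrightarrow> (\<exists>w. D = w \<partial>)"
proof
  assume D: "derivation D"
  interpret D: Vector_Spaces.linear smult smult D
    using D by (simp add: derivation_def)
  have leib: "D (p * q) = D p * q + p * D q" for p q
    using D by (simp add: derivation_def)
  have "D 1 = 0"
    using leib[of 1 1] by (simp only: mult_1_left mult_1_right add_cancel_right_right)
  then have const: "D [:c:] = 0" for c
    using D.scale[of c 1] by simp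
  have "D p = D [:0, 1:] * pderiv p" for p
  proof (induction p)
    case (pCons a p)
    have "pCons a p = [:a:] + [:0, 1:] * p"
      by simp
    then have "D (pCons a p) = D [:a:] + D ([:0, 1:] * p)"
      by (metis D.add)
    also have "\<dots> = D [:0, 1:] * p + [:0, 1:] * D p"
      by (simp only: const leib add_0)
    also have "\<dots> = D [:0, 1:] * pderiv (pCons a p)"
      by (simp add: pCons.IH pderiv_pCons algebra_simps)
    finally show ?case .
  qed (simp add: D.zero)
  then have "D = (D [:0, 1:]) \<partial>"
    unfolding vfield_def by (rule ext)
  then show "\<exists>w. D = w \<partial>" ..
qed (auto intro: derivation_vfield)

lemma vfield_inject: "v \<partial> = w \<partial> \<longleftrightarrow> v = w"
proof
  assume "v \<partial> = w \<partial>"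
  then have "(v \<partial>) [:0, 1:] = (w \<partial>) [:0, 1:]"
    by simp
  then show "v = w"
    by (simp add: vfield_def pderiv_pCons)
qed simp

lemma lie_bracket_vfield: "lie_bracket (v \<partial>) (w \<partial>) = (v * pderiv w - pderiv v * w) \<partial>"
  by (simp add: lie_bracket_def vfield_def fun_eq_iff pderiv_mult algebra_simps)

definition infinite_dimensional :: "('a::field poly \<Rightarrow> 'a poly) set \<Rightarrow> bool" where
  "infinite_dimensional V \<longleftrightarrow> (\<nexists>B. finite B \<and> endo.span B = V)"

text \<open>For subspaces \<open>U \<subseteq> V\<close>, the quotient \<open>V / U\<close> is spanned by the classes of the elements of
  \<open>B \<subseteq> V\<close> iff \<open>U\<close> and \<open>B\<close> together span \<open>V\<close>.\<close>

definition finite_codimension_in ::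
    "('a::field poly \<Rightarrow> 'a poly) set \<Rightarrow> ('a poly \<Rightarrow> 'a poly) set \<Rightarrow> bool" where
  "finite_codimension_in U V \<longleftrightarrow> (\<exists>B\<subseteq>V. finite B \<and> endo.span (U \<union> B) = V)"


section \<open>The Lie algebra attached to a non-constant polynomial\<close>

definition poly_subalg :: "'a::field poly \<Rightarrow> 'a poly set" where
  "poly_subalg f = range (\<lambda>p. pcompose p f)"

text \<open>For non-constant \<open>f\<close> a minimiser exists and is unique up to a nonzero scalar, so \<open>L_alg f\<close>
  below does not depend on the choice made by \<^const>\<open>arg_min\<close>.\<close>

definition g_min :: "'a::field poly \<Rightarrow> 'a poly" where
  "g_min f = (ARG_MIN degree g. g \<noteq> 0 \<and> pderiv f * g \<in> poly_subalg f)"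

definition L_alg :: "'a::field poly \<Rightarrow> ('a poly \<Rightarrow> 'a poly) set" where
  "L_alg f = {(pcompose p f * g_min f) \<partial> | p. True}"


section \<open>Ratios and subfields of the rational function field\<close>

definition ratios :: "('a::field poly \<Rightarrow> 'a poly) set \<Rightarrow> 'a poly fract set" where
  "ratios \<gg> = {Fraction_Field.Fract w u | w u. w \<partial> \<in> \<gg> \<and> u \<partial> \<in> \<gg> \<and> u \<noteq> 0}"

abbreviation ratfun_field :: "'a::field poly fract ring" where
  "ratfun_field \<equiv> ring_of_type_algebra"

definition adjoin :: "'a::field poly \<Rightarrow> 'a poly fract set" where
  "adjoin f = generate_field ratfun_field
     (insert (Fraction_Field.Fract f 1) (range (\<lambda>c. Fraction_Field.Fract [:c:] 1)))"

end

theory Submission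
  imports Defs
begin

text \<open>Write \<open>V\<close> for the space of all \<open>w\<close> with \<open>w \<partial> \<in> \<gg>\<close>. It is an infinite-dimensional space of
polynomials in \<open>t\<close> closed under the Wronskian \<open>v w' - v' w\<close>, and the ratios of \<open>\<gg>\<close> are the
quotients of elements of \<open>V\<close>.

If \<open>\<gg>\<close> has finite codimension in \<open>L(f)\<close>, then \<open>V = {p(f) g | p \<in> P}\<close> for a subspace \<open>P\<close> of
finite codimension in the polynomials. For any \<open>a\<close> and \<open>b\<close>, the multipliers \<open>c\<close> with \<open>a c \<in> P\<close>
and \<open>b c \<in> P\<close> again form a space of finite codimension, so some \<open>c \<noteq> 0\<close> turns \<open>a / b\<close> into a
quotient of elements of \<open>P\<close>. Hence the ratios fill \<open>\<bbbk>(f)\<close> (\<open>fractions_over_finite_codim\<close>,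
\<open>ratios_of_finite_codim\<close>).

Conversely, let the ratios form a field \<open>F\<close>. Its polynomial members form an algebra \<open>B\<close> in which
exact quotients stay. For a fixed nonzero \<open>u \<in> V\<close>, infinitely many independent elements of \<open>V\<close>
are multiples \<open>u b\<close>, because the multiples of \<open>u\<close> have finite codimension among all polynomials;
such \<open>b\<close> lie in \<open>B\<close>, so \<open>B\<close> contains a non-constant polynomial. By the polynomial form of
Lueroth's theorem (\<open>polynomial_lueroth\<close>), \<open>B = \<bbbk>[f]\<close>. Every element of \<open>F\<close> is a quotient of
elements of \<open>B\<close>, by the same count of dimensions, so \<open>F = \<bbbk>(f)\<close>.

The bracket enters in two places. First, \<open>f \<in> F\<close> means that \<open>u\<close> and \<open>f u\<close> lie in \<open>V\<close> for some \<open>u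
\<noteq> 0\<close>, and their bracket is \<open>f' u\<^sup>2 \<partial>\<close>. Multiplying \<open>f' u\<^sup>2 / u\<close> with \<open>v / u\<close> gives \<open>f' v \<in> B =
\<bbbk>[f]\<close> for all \<open>v \<in> V\<close>, and the \<open>v\<close> with this property are exactly the multiples of \<open>g_f\<close> by
elements of \<open>\<bbbk>[f]\<close>, by division with remainder in \<open>\<bbbk>[f]\<close>. So \<open>\<gg> \<subseteq> L(f)\<close>.

Second, the codimension. Write \<open>V = {p(f) g | p \<in> P}\<close> and \<open>f' g = h(f)\<close>; then \<open>P\<close> is closed
under \<open>h (p q' - p' q)\<close>. The leading terms cancel only for equal degrees, so the numbers \<open>degree
p + degree h - 1\<close> form a set of integers closed under sums of two distinct members. It is
unbounded as \<open>P\<close> is infinite-dimensional, and it contains two consecutive numbers, since \<open>f \<in> F\<close>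
says that \<open>q\<close> and \<open>x q\<close> lie in \<open>P\<close> for some \<open>q \<noteq> 0\<close>. Such a set contains all large integers
(\<open>cofinite_of_distinct_sums\<close>), so \<open>P\<close> meets all large degrees and has finite codimension.\<close>

section \<open>Subspaces of finite dimension and of finite codimension\<close>

definition (in vector_space) fin_dim :: "'b set \<Rightarrow> bool" where
  "fin_dim W \<longleftrightarrow> (\<exists>B. finite B \<and> span B = W)"

text \<open>By induction it suffices to add a single vector to \<open>U\<close>, and this raises the dimension of
the intersection with \<open>W\<close> by at most one: modulo the old intersection, every new vector is a
multiple of one fixed new vector.\<close>

lemma (in vector_space) not_fin_dim_Int_span:
  assumes "finite B" "subspace W" "\<not> fin_dim (W \<inter> span (U \<union> B))"
  shows "\<not> fin_dim (W \<inter> span U)"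
  using assms(1,3)
proof (induction B rule: finite_induct)
  case (insert b B)
  define S where "S = U \<union> B"
  have "fin_dim (W \<inter> span (insert b S))" if fin: "fin_dim (W \<inter> span S)"
  proof (cases "W \<inter> span (insert b S) \<subseteq> span S")
    case True
    then have "W \<inter> span (insert b S) = W \<inter> span S"
      using span_mono[of S "insert b S"] by auto
    then show ?thesis using fin by simp
  next
    case False
    then obtain w0 where w0: "w0 \<in> W" "w0 \<in> span (insert b S)" "w0 \<notin> span S" by blast
    then obtain k where k: "w0 - scale k b \<in> span S" by (auto simp: span_breakdown_eq)
    have k0: "k \<noteq> 0" using k w0(3) by auto
    obtain C where C: "finite C" "span C = W \<inter> span S" using fin by (auto simp: fin_dim_def)
    have CW: "C \<subseteq> W \<inter> span S" using C(2) span_superset by blast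
    have "span (insert w0 C) = W \<inter> span (insert b S)"
    proof
      have "subspace (W \<inter> span (insert b S))" using assms(2) by (intro subspace_inter subspace_span)
      moreover have "insert w0 C \<subseteq> W \<inter> span (insert b S)"
        using w0 CW span_mono[of S "insert b S"] by auto
      ultimately show "span (insert w0 C) \<subseteq> W \<inter> span (insert b S)" by (intro span_minimal)
      show "W \<inter> span (insert b S) \<subseteq> span (insert w0 C)"
      proof
        fix w assume w: "w \<in> W \<inter> span (insert b S)"
        then obtain j where j: "w - scale j b \<in> span S" by (auto simp: span_breakdown_eq)
        have "w - scale (j / k) w0 = (w - scale j b) - scale (j / k) (w0 - scale k b)"
          using k0 by (simp add: scale_right_diff_distrib)
        also have "\<dots> \<in> span S" by (rule span_diff[OF j span_scale[OF k]])
        finally have "w - scale (j / k) w0 \<in> span S" .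
        moreover have "w - scale (j / k) w0 \<in> W"
          using w w0(1) assms(2) by (auto intro: subspace_diff subspace_scale)
        ultimately show "w \<in> span (insert w0 C)"
          unfolding span_breakdown_eq C(2) by blast
      qed
    qed
    then show ?thesis using C(1) by (auto simp: fin_dim_def)
  qed
  with insert.prems insert.IH show ?case by (auto simp: S_def)
qed simp

lemma (in vector_space) fin_dim_zero: "fin_dim {0}"
  unfolding fin_dim_def by (rule exI[of _ "{}"]) simp

lemma (in vector_space) not_fin_dim_nonzero:
  assumes "\<not> fin_dim W" "subspace W"
  obtains w where "w \<in> W" "w \<noteq> 0"
proof -
  have "W \<noteq> {0}" using assms(1) fin_dim_zero by auto
  then show ?thesis using that subspace_0[OF assms(2)] by auto
qed

lemma (in vector_space) fin_dim_subspace: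
  assumes "finite B" "subspace W" "W \<subseteq> span B"
  shows "fin_dim W"
proof -
  have "W \<inter> span {} = {0}" using subspace_0[OF assms(2)] by auto
  moreover have "W \<inter> span ({} \<union> B) = W" using assms(3) by auto
  ultimately show ?thesis
    using not_fin_dim_Int_span[OF assms(1,2), of "{}"] fin_dim_zero by auto
qed

lemma (in Vector_Spaces.linear) fin_dim_inj_image_iff:
  assumes "inj f"
  shows "vs2.fin_dim (f ` W) \<longleftrightarrow> vs1.fin_dim W"
proof
  assume "vs1.fin_dim W"
  then obtain B where "finite B" "vs1.span B = W" unfolding vs1.fin_dim_def by blast
  then show "vs2.fin_dim (f ` W)"
    unfolding vs2.fin_dim_def by (intro exI[of _ "f ` B"]) (simp add: span_image)
next
  assume "vs2.fin_dim (f ` W)"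
  then obtain C where C: "finite C" "vs2.span C = f ` W" unfolding vs2.fin_dim_def by blast
  then have "C \<subseteq> f ` W" using vs2.span_superset by blast
  then obtain B where B: "B \<subseteq> W" "C = f ` B" by (auto simp: subset_image_iff)
  have "finite B" using C(1) B(2) assms by (simp add: finite_image_iff inj_on_subset)
  moreover have "f ` vs1.span B = f ` W" using C(2) B(2) by (simp add: span_image)
  then have "vs1.span B = W" using assms by (simp add: inj_image_eq_iff)
  ultimately show "vs1.fin_dim W" unfolding vs1.fin_dim_def by blast
qed

global_interpretation pvec: vector_space "smult :: 'a::field \<Rightarrow> 'a poly \<Rightarrow> 'a poly"
  by (rule smult_vector_space)

lemma pvec_subspaceI:
  assumes "0 \<in> W" "\<And>p q. p \<in> W \<Longrightarrow> q \<in> W \<Longrightarrow> p + q \<in> W" "\<And>c p. p \<in> W \<Longrightarrow> smult c p \<in> W"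
  shows "pvec.subspace W"
  unfolding pvec.subspace_def using assms by blast

lemma bounded_degree_fin_dim:
  assumes "pvec.subspace W" "\<And>w. w \<in> W \<Longrightarrow> degree w \<le> n"
  shows "pvec.fin_dim W"
proof (rule pvec.fin_dim_subspace[OF _ assms(1)])
  show "finite ((\<lambda>i. monom (1::'a) i) ` {..n})" by simp
  show "W \<subseteq> pvec.span ((\<lambda>i. monom 1 i) ` {..n})"
  proof
    fix w assume "w \<in> W"
    then have "w = (\<Sum>i\<le>n. monom (coeff w i) i)"
      using assms(2) by (simp add: poly_as_sum_of_monoms')
    also have "\<dots> = (\<Sum>i\<le>n. smult (coeff w i) (monom 1 i))" by (simp add: smult_monom)
    also have "\<dots> \<in> pvec.span ((\<lambda>i. monom 1 i) ` {..n})"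
      by (intro pvec.span_sum pvec.span_scale pvec.span_base) auto
    finally show "w \<in> pvec.span ((\<lambda>i. monom 1 i) ` {..n})" .
  qed
qed

lemma bounded_degree_subspace: "pvec.subspace {p. degree p \<le> n}"
  by (intro pvec_subspaceI) (auto intro: degree_add_le order_trans[OF degree_smult_le])

text \<open>With the converse above, this translates between dimensions and degrees: a subspace of
polynomials has finite dimension iff its degrees are bounded.\<close>

lemma fin_dim_bounded_degree:
  assumes "pvec.fin_dim W"
  obtains n where "\<And>w. w \<in> W \<Longrightarrow> degree w \<le> n"
proof -
  from assms obtain B where B: "finite B" "pvec.span B = W" by (auto simp: pvec.fin_dim_def)
  have "B \<subseteq> {p. degree p \<le> Max (degree ` B)}" using B(1) by auto
  then have "W \<subseteq> {p. degree p \<le> Max (degree ` B)}"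
    unfolding B(2)[symmetric] by (intro pvec.span_minimal bounded_degree_subspace)
  then show ?thesis using that by blast
qed

lemma not_fin_dim_UNIV: "\<not> pvec.fin_dim (UNIV :: 'a::field poly set)"
proof
  assume "pvec.fin_dim (UNIV :: 'a poly set)"
  then obtain n where "\<And>w::'a poly. degree w \<le> n" by (rule fin_dim_bounded_degree) auto
  from this[of "monom 1 (Suc n)"] show False by (simp add: degree_monom_eq)
qed

lemma subspace_multiples:
  fixes u :: "'a::field poly"
  shows "pvec.subspace (range ((*) u))"
proof (intro pvec_subspaceI)
  show "0 \<in> range ((*) u)" by (metis mult_zero_right rangeI)
next
  fix p q assume "p \<in> range ((*) u)" "q \<in> range ((*) u)"
  then show "p + q \<in> range ((*) u)" by (auto simp flip: distrib_left)
next
  fix c p assume "p \<in> range ((*) u)"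
  then show "smult c p \<in> range ((*) u)" by (auto simp flip: mult_smult_right)
qed

text \<open>The multiples of \<open>u\<close> have finite codimension: remainders modulo \<open>u\<close> have bounded degree.\<close>

lemma not_fin_dim_Int_multiples:
  fixes W :: "'a::field poly set"
  assumes "pvec.subspace W" "\<not> pvec.fin_dim W" "u \<noteq> 0"
  shows "\<not> pvec.fin_dim (W \<inter> range ((*) u))"
proof -
  define R where "R = {p :: 'a poly. degree p \<le> degree u}"
  have "pvec.fin_dim R" unfolding R_def
    by (rule bounded_degree_fin_dim[OF bounded_degree_subspace]) auto
  then obtain B where B: "finite B" "pvec.span B = R" by (auto simp: pvec.fin_dim_def)
  have "p \<in> pvec.span (range ((*) u) \<union> B)" for p
  proof -
    have "p = u * (p div u) + p mod u" by simp
    moreover have "u * (p div u) \<in> pvec.span (range ((*) u) \<union> B)" by (intro pvec.span_base) auto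
    moreover have "p mod u \<in> R"
      using degree_mod_less[OF assms(3), of p] by (auto simp: R_def)
    then have "p mod u \<in> pvec.span (range ((*) u) \<union> B)"
      using B(2) pvec.span_mono[of B "range ((*) u) \<union> B"] by auto
    ultimately show ?thesis by (metis pvec.span_add)
  qed
  then have "\<not> pvec.fin_dim (W \<inter> pvec.span (range ((*) u) \<union> B))"
    using assms(2) by (metis UNIV_eq_I inf_top.right_neutral)
  from pvec.not_fin_dim_Int_span[OF B(1) assms(1) this] show ?thesis
    using subspace_multiples[of u] by (metis pvec.span_eq_iff)
qed

text \<open>Multiplication by \<open>a \<noteq> 0\<close> is injective, so from an infinite-dimensional space of
candidates \<open>c\<close>, infinitely many independent ones satisfy \<open>a * c \<in> P\<close>. Imposing the two
conditions one after the other therefore leaves a nonzero \<open>c\<close>.\<close>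

lemma fractions_over_finite_codim:
  fixes P :: "'a::field poly set"
  assumes P: "pvec.subspace P" and B: "finite B" "pvec.span (P \<union> B) = UNIV"
  obtains c where "c \<noteq> 0" "a * c \<in> P" "b * c \<in> P"
proof -
  have lin: "Vector_Spaces.linear smult smult ((*) a)" for a :: "'a poly"
    by (simp add: Vector_Spaces.linear_iff smult_vector_space distrib_left)
  have preimage: "\<not> pvec.fin_dim (C \<inter> (*) a -` P)" if "pvec.subspace C" "\<not> pvec.fin_dim C" for C a
  proof (cases "a = 0")
    case True
    then have "C \<inter> (*) a -` P = C" using pvec.subspace_0[OF P] by auto
    then show ?thesis using that(2) by simp
  next
    case False
    interpret T: Vector_Spaces.linear smult smult "(*) a" by (rule lin)
    have inj: "inj ((*) a)" using False by (simp add: inj_def)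
    have "\<not> pvec.fin_dim ((*) a ` C \<inter> pvec.span (P \<union> B))"
      using that(2) B(2) T.fin_dim_inj_image_iff[OF inj] by simp
    from pvec.not_fin_dim_Int_span[OF B(1) T.subspace_image[OF that(1)] this]
    have "\<not> pvec.fin_dim ((*) a ` C \<inter> P)" using P by (simp add: pvec.span_eq_iff[THEN iffD2])
    also have "(*) a ` C \<inter> P = (*) a ` (C \<inter> (*) a -` P)" by auto
    finally show ?thesis using T.fin_dim_inj_image_iff[OF inj] by simp
  qed
  have sub: "pvec.subspace ((*) a -` P)" for a
  proof -
    interpret T: Vector_Spaces.linear smult smult "(*) a" by (rule lin)
    show ?thesis using P by (rule T.subspace_vimage)
  qed
  have "\<not> pvec.fin_dim ((*) a -` P)" using preimage[of UNIV a] not_fin_dim_UNIV by simp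
  then have "\<not> pvec.fin_dim ((*) a -` P \<inter> (*) b -` P)" by (intro preimage sub)
  then obtain c where "c \<in> (*) a -` P \<inter> (*) b -` P" "c \<noteq> 0"
    by (rule pvec.not_fin_dim_nonzero) (intro pvec.subspace_inter sub)
  then show ?thesis using that by auto
qed

section \<open>Subfields of the rational function field generated by one polynomial\<close>

lemma ratfun_simps:
  "carrier ratfun_field = UNIV" "x \<otimes>\<^bsub>ratfun_field\<^esub> y = x * y" "x \<oplus>\<^bsub>ratfun_field\<^esub> y = x + y"
  "\<one>\<^bsub>ratfun_field\<^esub> = 1" "\<zero>\<^bsub>ratfun_field\<^esub> = 0"
  by (simp_all add: ring_of_type_algebra_def)

lemma ratfun_minus: "\<ominus>\<^bsub>ratfun_field\<^esub> x = - (x :: 'a::field poly fract)"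
  by (rule abelian_group.minus_equality[OF ring.is_abelian_group[OF ring_from_type_algebra]])
    (simp_all add: ratfun_simps)

lemma ratfun_inv: "x \<noteq> 0 \<Longrightarrow> inv\<^bsub>ratfun_field\<^esub> x = inverse (x :: 'a::field poly fract)"
  by (rule monoid.inv_char[OF ring.is_monoid[OF ring_from_type_algebra]])
    (simp_all add: ratfun_simps)

lemma subfield_adjoin: "subfield (adjoin f) ratfun_field"
  unfolding adjoin_def by (rule field.generate_field_is_subfield[OF field_from_type_algebra])
    (simp add: ratfun_simps)

lemma subfield_ratfunD:
  assumes "subfield K (ratfun_field :: 'a::field poly fract ring)"
  shows "x \<in> K \<Longrightarrow> y \<in> K \<Longrightarrow> x + y \<in> K" and "x \<in> K \<Longrightarrow> y \<in> K \<Longrightarrow> x * y \<in> K"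
  using subringE(6,7)[OF subfieldE(1)[OF assms]] by (simp_all add: ratfun_simps)

lemma adjoin_eq:
  "adjoin f = {Fraction_Field.Fract (pcompose p f) (pcompose q f) | p q. pcompose q f \<noteq> 0}"
  (is "_ = ?K")
proof
  let ?H = "insert (Fraction_Field.Fract f 1) (range (\<lambda>c. Fraction_Field.Fract [:c:] 1))"
  show "?K \<subseteq> adjoin f"
  proof
    fix x assume "x \<in> ?K"
    then obtain p q where x: "x = Fraction_Field.Fract (pcompose p f) (pcompose q f)"
        "pcompose q f \<noteq> 0" by blast
    have pol: "Fraction_Field.Fract (pcompose p f) 1 \<in> adjoin f" for p
    proof (induction p)
      case 0
      have "Fraction_Field.Fract [:0:] 1 \<in> adjoin f"
        unfolding adjoin_def by (rule generate_field.incl) (rule insertI2, rule rangeI)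
      then show ?case by simp
    next
      case (pCons a p)
      have "Fraction_Field.Fract f 1 \<in> adjoin f" "Fraction_Field.Fract [:a:] 1 \<in> adjoin f"
        unfolding adjoin_def by (auto intro: generate_field.incl)
      then have "Fraction_Field.Fract [:a:] 1
          + Fraction_Field.Fract f 1 * Fraction_Field.Fract (pcompose p f) 1 \<in> adjoin f"
        using pCons.IH subfield_ratfunD[OF subfield_adjoin] by blast
      then show ?case by (simp add: pcompose_pCons)
    qed
    have "Fraction_Field.Fract (pcompose q f) 1 \<noteq> 0"
      using x(2) by (simp add: Zero_fract_def eq_fract)
    with pol[of q] have "inverse (Fraction_Field.Fract (pcompose q f) 1) \<in> adjoin f"
      using generate_field.m_inv[of "Fraction_Field.Fract (pcompose q f) 1" ratfun_field ?H]
      by (simp add: adjoin_def ratfun_simps ratfun_inv)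
    with pol[of p]
    have "Fraction_Field.Fract (pcompose p f) 1 * inverse (Fraction_Field.Fract (pcompose q f) 1) \<in> adjoin f"
      using subfield_ratfunD[OF subfield_adjoin] by blast
    then show "x \<in> adjoin f" by (simp add: x)
  qed
  have KI: "Fraction_Field.Fract (pcompose p f) (pcompose q f) \<in> ?K" if "pcompose q f \<noteq> 0" for p q
    using that by blast
  show "adjoin f \<subseteq> ?K"
  proof
    fix x assume "x \<in> adjoin f"
    then show "x \<in> ?K"
      unfolding adjoin_def
    proof (induction rule: generate_field.induct)
      case one
      then show ?case using KI[of 1 1] by (simp add: ratfun_simps One_fract_def pcompose_1)
    next
      case (incl h)
      then consider "h = Fraction_Field.Fract f 1" | c where "h = Fraction_Field.Fract [:c:] 1" by blast
      then show ?case
      proof cases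
        case 1
        then show ?thesis using KI[of 1 "[:0, 1:]"] by (simp add: pcompose_pCons pcompose_1)
      next
        case 2
        then show ?thesis using KI[of 1 "[:c:]"] by (simp add: pcompose_1)
      qed
    next
      case (a_inv h)
      then obtain p q where "h = Fraction_Field.Fract (pcompose p f) (pcompose q f)"
        "pcompose q f \<noteq> 0" by blast
      then show ?case using KI[of q "- p"] by (simp add: ratfun_minus pcompose_uminus)
    next
      case (m_inv h)
      then obtain p q where h: "h = Fraction_Field.Fract (pcompose p f) (pcompose q f)"
        "pcompose q f \<noteq> 0" by blast
      have "h \<noteq> 0" using m_inv by (simp add: ratfun_simps)
      then have "pcompose p f \<noteq> 0" using h by (auto simp: Zero_fract_def eq_fract)
      then show ?case using KI[of p q] \<open>h \<noteq> 0\<close> by (simp add: ratfun_inv h)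
    next
      case (eng_add h1 h2)
      then obtain p q p' q' where
        "h1 = Fraction_Field.Fract (pcompose p f) (pcompose q f)" "pcompose q f \<noteq> 0"
        "h2 = Fraction_Field.Fract (pcompose p' f) (pcompose q' f)" "pcompose q' f \<noteq> 0" by blast
      then show ?case using KI[of "q * q'" "p * q' + p' * q"]
        by (simp add: ratfun_simps pcompose_mult pcompose_add)
    next
      case (eng_mult h1 h2)
      then obtain p q p' q' where
        "h1 = Fraction_Field.Fract (pcompose p f) (pcompose q f)" "pcompose q f \<noteq> 0"
        "h2 = Fraction_Field.Fract (pcompose p' f) (pcompose q' f)" "pcompose q' f \<noteq> 0" by blast
      then show ?case using KI[of "q * q'" "p * p'"]
        by (simp add: ratfun_simps pcompose_mult)
    qed
  qed
qed

section \<open>Gauss's lemma over the polynomials in one variable\<close>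

lemma exists_prime_divisor_poly:
  fixes a :: "'a::field poly"
  assumes "degree a > 0"
  obtains q where "prime_elem q" "q dvd a" "degree q > 0"
proof -
  define n where "n = (LEAST n. \<exists>q. q dvd a \<and> degree q = n \<and> n > 0)"
  have ex: "\<exists>n q. q dvd a \<and> degree q = n \<and> n > 0"
    using assms by (intro exI[of _ "degree a"] exI[of _ a]) simp
  from LeastI_ex[OF ex] obtain q where q: "q dvd a" "degree q = n" "n > 0"
    unfolding n_def by blast
  have least: "n \<le> degree r" if "r dvd a" "degree r > 0" for r
    unfolding n_def by (rule Least_le) (use that in auto)
  have "irreducible q"
  proof (rule Factorial_Ring.irreducibleI)
    show "q \<noteq> 0" using q by auto
    then show "\<not> is_unit q" using q by (simp add: is_unit_iff_degree)
    fix r s assume rs: "q = r * s"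
    then have nz: "r \<noteq> 0" "s \<noteq> 0" using \<open>q \<noteq> 0\<close> by auto
    then have deg: "degree r + degree s = n" using rs q by (simp add: degree_mult_eq)
    show "is_unit r \<or> is_unit s"
    proof (cases "degree r = 0")
      case True
      then show ?thesis using nz by (simp add: is_unit_iff_degree)
    next
      case False
      have "r dvd q" by (simp add: rs)
      then have "n \<le> degree r" using least[of r] False q(1) dvd_trans by blast
      then show ?thesis using nz deg by (simp add: is_unit_iff_degree)
    qed
  qed
  then show ?thesis using that[of q] q by (simp add: field_poly_irreducible_imp_prime)
qed

definition primitive :: "'a::field poly poly \<Rightarrow> bool" where
  "primitive G \<longleftrightarrow> (\<forall>c. [:c:] dvd G \<longrightarrow> is_unit c)"

text \<open>Divide by a common divisor of the coefficients of largest degree: a non-unit common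
divisor of the resulting coefficients would enlarge it.\<close>

lemma primitive_part_exists:
  fixes G :: "'a::field poly poly"
  assumes "G \<noteq> 0"
  obtains c H where "G = smult c H" "c \<noteq> 0" "primitive H"
proof -
  have bd: "degree c \<le> degree (lead_coeff G)" if "[:c:] dvd G" for c
    using that assms
    using that assms by (intro dvd_imp_degree_le) (simp_all add: const_poly_dvd_iff)
  have "[:1:] dvd G" by (simp flip: one_pCons)
  then have "\<exists>c. [:c:] dvd G \<and> (\<forall>e. [:e:] dvd G \<longrightarrow> degree e \<le> degree c)"
    by (rule ex_has_greatest_nat[of _ _ _ "Suc (degree (lead_coeff G))"])
      (simp add: bd less_Suc_eq_le)
  then obtain c where c: "[:c:] dvd G" and max: "\<And>e. [:e:] dvd G \<Longrightarrow> degree e \<le> degree c"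
    by blast
  from c obtain H where H: "G = smult c H" by auto
  have c0: "c \<noteq> 0" "H \<noteq> 0" using H assms by auto
  have "is_unit e" if "[:e:] dvd H" for e
  proof -
    from that obtain K where K: "H = smult e K" by auto
    then have e0: "e \<noteq> 0" using c0 by auto
    have "[:c * e:] dvd G" using H K by (simp add: const_poly_dvd_iff)
    from max[OF this] show ?thesis using c0 e0 by (simp add: degree_mult_eq is_unit_iff_degree)
  qed
  then show ?thesis using that[OF H c0(1)] by (simp add: primitive_def)
qed

text \<open>Gauss's lemma in the form used below. A prime factor of \<open>a\<close> remains prime as a constant of
the polynomial ring over \<open>\<bbbk>[t]\<close>; it cannot divide the primitive \<open>G\<close>, so it divides \<open>Q\<close> and can
be cancelled.\<close>

lemma primitive_dvd_cancel:
  fixes P G Q :: "'a::field poly poly"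
  assumes "smult a P = Q * G" and "a \<noteq> 0" and "primitive G"
  shows "G dvd P"
  using assms(1,2)
proof (induction "degree a" arbitrary: a Q rule: less_induct)
  case less
  show ?case
  proof (cases "degree a = 0")
    case True
    then have "is_unit a" using less.prems by (simp add: is_unit_iff_degree)
    then obtain b where b: "1 = a * b" by (rule dvdE)
    have "P = smult b (smult a P)" by (simp add: b[symmetric] mult.commute[of b])
    also have "\<dots> = smult b Q * G" using less.prems by simp
    finally show ?thesis by (metis dvd_triv_right)
  next
    case False
    then obtain q where q: "prime_elem q" "q dvd a" "degree q > 0"
      using exists_prime_divisor_poly by blast
    then obtain a' where a': "a = q * a'" by auto
    have "[:q:] dvd Q * G"
      unfolding less.prems(1)[symmetric] using q(2) by (simp add: a' const_poly_dvd_iff)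
    moreover have "\<not> [:q:] dvd G"
      using assms(3) q(1) by (auto simp: primitive_def)
    ultimately have "[:q:] dvd Q"
      using lift_prime_elem_poly[OF q(1)] by (simp add: prime_elem_dvd_mult_iff)
    then obtain Q' where Q': "Q = smult q Q'" by auto
    have q0: "q \<noteq> 0" using q by auto
    have "smult q (smult a' P) = smult q (Q' * G)"
      using less.prems(1) by (simp add: a' Q')
    then have "smult a' P = Q' * G"
      by (rule smult_cancel[OF q0])
    moreover have "degree a' < degree a" "a' \<noteq> 0"
      using less.prems(2) q(3) q0 by (auto simp: a' degree_mult_eq)
    ultimately show ?thesis by (intro less.hyps[of a' Q'])
  qed
qed

section \<open>The polynomial form of the theorem of Lueroth\<close>

text \<open>Polynomials over \<open>'a poly\<close> are polynomials in an outer variable \<open>X\<close> whose coefficients are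
polynomials in \<open>t\<close>. In this notation, \<open>gap p\<close> is \<open>p(X) - p(t)\<close>, which vanishes at \<open>X = t\<close>.\<close>

definition gap :: "'a::comm_ring_1 poly \<Rightarrow> 'a poly poly" where
  "gap p = map_poly (\<lambda>c. [:c:]) p - [:p:]"

lemma coeff_gap: "coeff (gap p) i = [:coeff p i:] - (if i = 0 then p else 0)"
  by (simp add: gap_def coeff_map_poly coeff_pCons split: nat.split)

lemma poly_gap: "poly (gap p) q = pcompose p q - p"
  by (simp add: gap_def pcompose_altdef)

lemma coeff_poly_const:
  fixes P :: "'a::comm_ring_1 poly poly"
  shows "coeff (poly P [:x:]) k = poly (map_poly (\<lambda>q. coeff q k) P) x"
  by (induction P) (simp_all add: map_poly_pCons)

lemma degree_gap:
  fixes p :: "'a::comm_ring_1 poly"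
  shows "degree (gap p) = degree p"
proof (cases "degree p = 0")
  case True
  then obtain c where "p = [:c:]" by (rule degree_eq_zeroE)
  then show ?thesis by (simp add: gap_def map_poly_pCons)
next
  case False
  then have "degree [:p:] < degree (map_poly (\<lambda>c. [:c:]) p)"
    by (simp add: degree_map_poly)
  then show ?thesis
    using degree_add_eq_left[of "- [:p:]" "map_poly (\<lambda>c. [:c:]) p"]
    unfolding gap_def diff_conv_add_uminus by (simp add: degree_map_poly)
qed

text \<open>Such a \<open>B\<close> is the intersection of \<open>\<bbbk>[t]\<close> with a subfield of \<open>\<bbbk>(t)\<close> containing \<open>\<bbbk>\<close>. Working
with \<open>B\<close> keeps the proof of Lueroth's theorem inside polynomial rings.\<close>

locale saturated_subalgebra =
  fixes B :: "'a::field_char_0 poly set"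
  assumes const: "[:c:] \<in> B"
    and add: "p \<in> B \<Longrightarrow> q \<in> B \<Longrightarrow> p + q \<in> B"
    and mult: "p \<in> B \<Longrightarrow> q \<in> B \<Longrightarrow> p * q \<in> B"
    and cancel: "b * h \<in> B \<Longrightarrow> b \<in> B \<Longrightarrow> b \<noteq> 0 \<Longrightarrow> h \<in> B"
begin

lemma zero: "0 \<in> B" using const[of 0] by simp

lemma diff: "p \<in> B \<Longrightarrow> q \<in> B \<Longrightarrow> p - q \<in> B"
  using add[of p "[:-1:] * q"] mult[OF const[of "-1"], of q] by simp

definition polys :: "'a poly poly set" where
  "polys = {P. \<forall>i. coeff P i \<in> B}"

lemma gap_in_polys: "p \<in> B \<Longrightarrow> gap p \<in> polys"
  by (simp add: polys_def coeff_gap diff const zero)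

text \<open>Over the fraction field of \<open>B\<close>, the hypotheses make \<open>G\<close> a minimal polynomial of \<open>t\<close> up to
a factor, and it divides every \<open>P\<close> that vanishes at \<open>t\<close>. The factor \<open>a\<close> clears the denominators.
It is a power of the leading coefficient of \<open>G\<close>, collected while the degree of \<open>P\<close> is lowered.\<close>

lemma pseudo_division:
  assumes "G \<in> polys" "G \<noteq> 0" and root: "poly G [:0, 1:] = 0"
    and minimal: "\<And>P. P \<in> polys \<Longrightarrow> poly P [:0, 1:] = 0 \<Longrightarrow> P \<noteq> 0 \<Longrightarrow> degree G \<le> degree P"
    and "P \<in> polys" "poly P [:0, 1:] = 0"
  shows "\<exists>a Q. a \<noteq> 0 \<and> smult a P = Q * G"
  using assms(5,6)
proof (induction "degree P" arbitrary: P rule: less_induct)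
  case less
  show ?case
  proof (cases "P = 0")
    case True
    then show ?thesis by (intro exI[of _ 1] exI[of _ 0]) simp
  next
    case False
    define l where "l = lead_coeff G"
    define m where "m = monom (lead_coeff P) (degree P - degree G)"
    define P' where "P' = smult l P - m * G"
    have l: "l \<noteq> 0" "l \<in> B" using assms(1,2) by (auto simp: l_def polys_def)
    have le: "degree G \<le> degree P" using minimal less.prems False by blast
    have P': "P' \<in> polys" "poly P' [:0, 1:] = 0"
      using less.prems assms(1) root l
      by (auto simp: P'_def polys_def m_def coeff_monom_mult intro!: diff mult zero)
    have mG: "degree (m * G) = degree P"
      using False assms(2) le by (simp add: m_def degree_mult_eq degree_monom_eq)
    have "lead_coeff (m * G) = l * lead_coeff P"
    proof -
      have "lead_coeff m = lead_coeff P" by (cases "P = 0") (simp_all add: m_def degree_monom_eq)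
      then show ?thesis by (simp only: lead_coeff_mult l_def mult.commute)
    qed
    have cP': "coeff P' (degree P) = 0"
      using \<open>lead_coeff (m * G) = l * lead_coeff P\<close> mG by (simp add: P'_def)
    have "degree P' \<le> degree P"
      unfolding P'_def using mG by (intro degree_diff_le) auto
    show ?thesis
    proof (cases "P' = 0")
      case True
      then show ?thesis using l by (intro exI[of _ l] exI[of _ m]) (simp add: P'_def)
    next
      case False
      with cP' \<open>degree P' \<le> degree P\<close> have "degree P' < degree P"
        by (metis le_neq_implies_less leading_coeff_0_iff)
      from less.hyps[OF this P'] obtain a Q where a: "a \<noteq> 0" "smult a P' = Q * G" by blast
      have "smult (a * l) P = (Q + smult a m) * G"
        using a(2) by (simp add: P'_def smult_diff_right algebra_simps)
      then show ?thesis using a l by (intro exI[of _ "a*l"] exI[of _ "Q + smult a m"]) simp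
    qed
  qed
qed

text \<open>\<open>G\<close> is the monic minimal polynomial of \<open>t\<close> over the fraction field of \<open>B\<close>. The point is
that its coefficients are polynomials: by Gauss's lemma its primitive multiple divides \<open>gap p0\<close>,
whose leading coefficient is a unit, so the primitive multiple is already monic up to a unit.
That the coefficients lie in \<open>B\<close> is then an instance of exact division in \<open>B\<close>.\<close>

lemma common_divisor_of_gaps:
  assumes p0: "p0 \<in> B" "degree p0 > 0"
  obtains G where "G \<in> polys" "lead_coeff G = 1" "poly G [:0, 1:] = 0"
    "\<And>p. p \<in> B \<Longrightarrow> G dvd gap p"
proof -
  define R where "R = {P \<in> polys. poly P [:0, 1:] = 0 \<and> P \<noteq> 0}"
  have "gap p0 \<noteq> 0" using p0(2) degree_gap[of p0] by auto
  then have "gap p0 \<in> R" using p0 by (simp add: R_def gap_in_polys poly_gap)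
  then obtain G0 where G0: "G0 \<in> R" and min: "\<And>P. P \<in> R \<Longrightarrow> degree G0 \<le> degree P"
    using ex_has_least_nat[of "\<lambda>P. P \<in> R" "gap p0" degree] by blast
  from G0 obtain c G1 where G1: "G0 = smult c G1" "c \<noteq> 0" "primitive G1"
    using primitive_part_exists[of G0] by (auto simp: R_def)
  have G1dvd: "G1 dvd gap p" if p: "p \<in> B" for p
  proof -
    obtain a Q where "a \<noteq> 0" "smult a (gap p) = Q * G0"
      using pseudo_division[of G0 "gap p"] G0 min p by (auto simp: R_def gap_in_polys poly_gap)
    then have "smult a (gap p) = smult c Q * G1" by (simp add: G1(1))
    then show ?thesis using primitive_dvd_cancel \<open>a \<noteq> 0\<close> G1(3) by blast
  qed
  from G1dvd[OF p0(1)] obtain H where H: "gap p0 = G1 * H" by auto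
  have "lead_coeff (gap p0) = [:lead_coeff p0:]"
    using p0(2) by (simp add: degree_gap coeff_gap)
  then have "lead_coeff G1 * lead_coeff H = [:lead_coeff p0:]" using H by (simp add: lead_coeff_mult)
  moreover have "is_unit [:lead_coeff p0:]" using p0(2) by (subst is_unit_iff_degree) auto
  ultimately have "is_unit (lead_coeff G1 * lead_coeff H)" by simp
  then have "is_unit (lead_coeff G1)" by (simp only: is_unit_mult_iff)
  then obtain e where "1 = lead_coeff G1 * e" by (rule dvdE)
  then have e: "e * lead_coeff G1 = 1" by (simp add: mult.commute)
  define G where "G = smult e G1"
  have lc: "lead_coeff G = 1" unfolding G_def lead_coeff_smult by (rule e)
  have "smult (lead_coeff G0) G = smult (c * (e * lead_coeff G1)) G1"
    by (simp add: G_def G1(1) ac_simps)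
  then have G0': "G0 = smult (lead_coeff G0) G" by (simp only: e mult_1_right G1(1))
  have l0: "lead_coeff G0 \<noteq> 0" "lead_coeff G0 \<in> B" using G0 by (auto simp: R_def polys_def)
  have "G \<in> polys" unfolding polys_def
  proof (safe)
    fix i
    have "lead_coeff G0 * coeff G i \<in> B"
    proof -
      have "coeff G0 i \<in> B" using G0 by (simp add: R_def polys_def)
      then show ?thesis using arg_cong[OF G0', of "\<lambda>P. coeff P i"] by simp
    qed
    then show "coeff G i \<in> B" using cancel l0 by blast
  qed
  moreover have "poly G [:0, 1:] = 0" using G0 G1 by (simp add: R_def G_def)
  moreover have "G dvd gap p" if "p \<in> B" for p
  proof -
    obtain K where "gap p = G1 * K" using G1dvd[OF \<open>p \<in> B\<close>] by auto
    then have "gap p = G * smult (lead_coeff G1) K"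
      using e by (simp add: G_def mult.commute)
    then show ?thesis by (rule dvdI)
  qed
  ultimately show ?thesis using that lc by blast
qed

text \<open>Let \<open>f\<close> be a coefficient of the minimal polynomial \<open>G\<close> of largest degree \<open>r\<close> in \<open>t\<close>. It is
not constant, since \<open>t\<close> is transcendental over \<open>\<bbbk>\<close>. Now \<open>G\<close> divides \<open>f(X) - f(t)\<close>, and both have
degree \<open>r\<close> in \<open>t\<close>, so the cofactor \<open>H\<close> does not involve \<open>t\<close>. As the coefficient of \<open>t^r\<close> in
\<open>f(X) - f(t)\<close> is a constant, \<open>H\<close> does not involve \<open>X\<close> either. Hence \<open>f(X) - f(t)\<close> is a constant
multiple of \<open>G\<close> and divides \<open>p(X) - p(t)\<close> for all \<open>p \<in> B\<close>. At \<open>X = 0\<close> this says that \<open>f - f(0)\<close>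
divides \<open>p - p(0)\<close>; the quotient is in \<open>B\<close> and has smaller degree than \<open>p\<close>, so induction on the
degree gives \<open>p \<in> \<bbbk>[f]\<close>.\<close>

theorem polynomial_lueroth:
  assumes p0: "p0 \<in> B" "degree p0 > 0"
  obtains f where "degree f > 0" "B = range (\<lambda>p. pcompose p f)"
proof -
  obtain G where G: "G \<in> polys" "lead_coeff G = 1" "poly G [:0, 1:] = 0"
    and Gdvd: "\<And>p. p \<in> B \<Longrightarrow> G dvd gap p"
    using common_divisor_of_gaps[OF p0] by blast
  have "degree (coeff G j) \<le> (\<Sum>j\<le>degree G. degree (coeff G j))" for j
    by (cases "j \<le> degree G") (auto intro: member_le_sum simp: coeff_eq_0)
  then have "\<exists>i. True \<and> (\<forall>j. True \<longrightarrow> degree (coeff G j) \<le> degree (coeff G i))"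
    by (intro ex_has_greatest_nat[of _ 0 _ "Suc (\<Sum>j\<le>degree G. degree (coeff G j))"])
      (auto simp: less_Suc_eq_le)
  then obtain i where i: "\<And>j. degree (coeff G j) \<le> degree (coeff G i)" by blast
  define f where "f = coeff G i"
  define r where "r = degree f"
  have f: "f \<in> B" using G(1) by (simp add: f_def polys_def)
  have r: "r > 0"
  proof (rule ccontr)
    assume "\<not> r > 0"
    then have "degree (coeff G j) = 0" for j using i[of j] by (simp add: r_def f_def)
    then have "[:coeff (coeff G j) 0:] = coeff G j" for j by (rule degree_0_id)
    then have "G = map_poly (\<lambda>c. [:c:]) (map_poly (\<lambda>q. coeff q 0) G)"
      by (intro poly_eqI) (simp add: coeff_map_poly)
    then have "map_poly (\<lambda>q. coeff q 0) G = 0"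
      using G(3) by (metis pcompose_altdef pcompose_idR)
    then show False
      using G(2) by (metis \<open>G = map_poly (\<lambda>c. [:c:]) (map_poly (\<lambda>q. coeff q 0) G)\<close> leading_coeff_0_iff
          map_poly_0 zero_neq_one)
  qed
  obtain H where H: "gap f = G * H" using Gdvd[OF f] by auto
  \<comment> \<open>The coefficients of \<open>t^r\<close> in \<open>G\<close> and of \<open>t^0\<close> in \<open>H\<close>, as polynomials in \<open>X\<close>.\<close>
  define g where "g = map_poly (\<lambda>q. coeff q r) G"
  define h where "h = map_poly (\<lambda>q. coeff q 0) H"
  define l where "l = lead_coeff f"
  have l0: "l \<noteq> 0" using r by (auto simp: l_def r_def)
  have g0: "g \<noteq> 0"
  proof
    assume "g = 0"
    then have "coeff g i = 0" by simp
    then show False using l0 by (simp add: g_def coeff_map_poly l_def r_def f_def)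
  qed
  \<comment> \<open>Specialise \<open>X\<close> to a scalar \<open>x\<close> and compare degrees in \<open>t\<close>; the field is infinite, so this
    determines \<open>g * h\<close>.\<close>
  have main: "poly (g * h) x = - l" if x: "poly g x \<noteq> 0" for x
  proof -
    have "coeff (poly G [:x:]) k = 0" if "k > r" for k
    proof -
      have "coeff (coeff G j) k = 0" for j using that i[of j] by (simp add: r_def f_def coeff_eq_0)
      then have "map_poly (\<lambda>q. coeff q k) G = 0" by (intro poly_eqI) (simp add: coeff_map_poly)
      then show ?thesis by (simp add: coeff_poly_const)
    qed
    then have "degree (poly G [:x:]) \<le> r" by (intro degree_le) auto
    moreover have cg: "coeff (poly G [:x:]) r = poly g x" by (simp add: coeff_poly_const g_def)
    ultimately have dG: "degree (poly G [:x:]) = r" using x by (intro antisym le_degree) auto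
    have prod: "poly G [:x:] * poly H [:x:] = [:poly f x:] - f"
      using poly_gap[of f "[:x:]"] by (simp add: H pcompose_pCons_0)
    have dr: "degree ([:poly f x:] - f) = r"
      using degree_add_eq_right[of "[:poly f x:]" "-f"] r by (simp add: r_def)
    have nz: "poly G [:x:] \<noteq> 0" "poly H [:x:] \<noteq> 0" using prod dr r by auto
    then have dH: "degree (poly H [:x:]) = 0"
      using arg_cong[OF prod, of degree] dr dG by (simp add: degree_mult_eq)
    have "poly g x * poly h x = lead_coeff (poly G [:x:]) * lead_coeff (poly H [:x:])"
      using dG dH cg by (simp add: coeff_poly_const h_def)
    also have "\<dots> = lead_coeff ([:poly f x:] - f)" unfolding prod[symmetric] lead_coeff_mult ..
    also have "\<dots> = - l" using r unfolding dr by (simp add: l_def r_def coeff_pCons split: nat.split)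
    finally show ?thesis by simp
  qed
  have "poly ((g * h + [:l:]) * g) x = 0" for x using main[of x] by (cases "poly g x = 0") simp_all
  then have "(g * h + [:l:]) * g = 0" using poly_all_0_iff_0 by blast
  then have "g * h + [:l:] = 0" using g0 by simp
  then have "g * h = - [:l:]" by (simp only: eq_neg_iff_add_eq_0)
  then have "g * h = [:-l:]" by simp
  then have dh: "degree h = 0" using l0
    by (metis add_is_0 degree_mult_eq degree_pCons_0 mult_eq_0_iff neg_equal_0_iff_equal pCons_eq_0_iff)
  have lH: "lead_coeff H = [:l:]"
  proof -
    have "lead_coeff H = lead_coeff (gap f)" using G(2) by (simp add: H lead_coeff_mult)
    also have "\<dots> = [:l:]" using r by (simp add: degree_gap coeff_gap l_def r_def)
    finally show ?thesis .
  qed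
  have "coeff h (degree H) = l" using lH by (simp add: h_def coeff_map_poly)
  then have "degree H = 0" using dh l0 by (metis le_degree le_zero_eq)
  then have "H = [:[:l:]:]" using lH by (metis degree_0_id)
  then have gapf: "gap f = smult [:l:] G" by (simp add: H)
  have quot: "\<exists>h. p - [:coeff p 0:] = (f - [:coeff f 0:]) * h" if p: "p \<in> B" for p
  proof -
    obtain K where K: "gap p = G * K" using Gdvd[OF p] by auto
    have "smult [:l:] (gap p) = gap f * K" by (simp add: K gapf)
    from arg_cong[OF this, of "\<lambda>P. poly P 0"]
    have "smult l ([:coeff p 0:] - p) = ([:coeff f 0:] - f) * poly K 0"
      by (simp add: poly_gap pcompose_0')
    moreover have "smult l (p - [:coeff p 0:]) = - smult l ([:coeff p 0:] - p)"
      by (simp only: smult_diff_right minus_diff_eq)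
    ultimately have "smult l (p - [:coeff p 0:]) = (f - [:coeff f 0:]) * poly K 0"
      by (simp add: algebra_simps)
    then have "smult (inverse l) (smult l (p - [:coeff p 0:]))
        = (f - [:coeff f 0:]) * smult (inverse l) (poly K 0)" by simp
    then have "p - [:coeff p 0:] = (f - [:coeff f 0:]) * smult (inverse l) (poly K 0)"
      using l0 by simp
    then show ?thesis by blast
  qed
  have "p \<in> range (\<lambda>p. pcompose p f)" if "p \<in> B" for p
    using that
  proof (induction "degree p" arbitrary: p rule: less_induct)
    case less
    show ?case
    proof (cases "degree p = 0")
      case True
      then obtain c where "p = [:c:]" by (rule degree_eq_zeroE)
      then show ?thesis by (metis pcompose_const rangeI)
    next
      case False
      obtain h where h: "p - [:coeff p 0:] = (f - [:coeff f 0:]) * h" using quot less.prems by blast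
      have df: "degree (f - [:coeff f 0:]) = r"
        using degree_add_eq_left[of "- [:coeff f 0:]" f] r
        unfolding diff_conv_add_uminus by (simp add: r_def)
      have dp: "degree (p - [:coeff p 0:]) = degree p"
        using degree_add_eq_left[of "- [:coeff p 0:]" p] False
        unfolding diff_conv_add_uminus by simp
      have nz: "f - [:coeff f 0:] \<noteq> 0" "h \<noteq> 0" using df dp h r False by auto
      have "degree h < degree p" using dp h df r nz by (simp add: degree_mult_eq)
      moreover have "h \<in> B"
      proof (rule cancel)
        show "(f - [:coeff f 0:]) * h \<in> B" unfolding h[symmetric] using less.prems by (intro diff const)
        show "f - [:coeff f 0:] \<in> B" using f by (intro diff const)
      qed (use nz in auto)
      ultimately obtain q where q: "h = pcompose q f" using less.hyps by blast
      have "p = [:coeff p 0:] + (f - [:coeff f 0:]) * h" using h by (simp add: algebra_simps)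
      also have "\<dots> = pcompose ([:coeff p 0:] + ([:0, 1:] - [:coeff f 0:]) * q) f"
        by (simp only: pcompose_add pcompose_mult pcompose_diff pcompose_const q) (simp add: pcompose_pCons)
      finally show ?thesis by blast
    qed
  qed
  moreover have "pcompose p f \<in> B" for p
    by (induction p) (auto simp: pcompose_pCons intro: add mult const f zero)
  ultimately have "B = range (\<lambda>p. pcompose p f)" by blast
  then show ?thesis using that[of f] r by (simp add: r_def)
qed

end

section \<open>Ratios that form a field\<close>

definition quotients :: "'a::field poly set \<Rightarrow> 'a poly fract set" where
  "quotients V = {Fraction_Field.Fract w u | w u. w \<in> V \<and> u \<in> V \<and> u \<noteq> 0}"

lemma quotientsI: "w \<in> V \<Longrightarrow> u \<in> V \<Longrightarrow> u \<noteq> 0 \<Longrightarrow> Fraction_Field.Fract w u \<in> quotients V"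
  by (auto simp: quotients_def)

lemma ratios_eq_quotients: "ratios \<gg> = quotients {w. w \<partial> \<in> \<gg>}"
  by (simp add: ratios_def quotients_def)

text \<open>These are the coefficients of the infinite-dimensional Lie subalgebras: the bracket of \<open>v
\<partial>\<close> and \<open>w \<partial>\<close> is \<open>(v w' - v' w) \<partial>\<close>.\<close>

locale wronskian_closed =
  fixes V :: "'a::field_char_0 poly set"
  assumes subspace: "pvec.subspace V"
    and wronskian: "v \<in> V \<Longrightarrow> w \<in> V \<Longrightarrow> v * pderiv w - pderiv v * w \<in> V"
    and infinite: "\<not> pvec.fin_dim V"
begin

lemma nonzero_element: obtains u where "u \<in> V" "u \<noteq> 0"
  using pvec.not_fin_dim_nonzero[OF infinite subspace] by blast

definition polynomial_quotients :: "'a poly set" where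
  "polynomial_quotients = {b. Fraction_Field.Fract b 1 \<in> quotients V}"

lemma polynomial_quotients_iff:
  "u \<noteq> 0 \<Longrightarrow> w = b * u \<Longrightarrow> b \<in> polynomial_quotients \<longleftrightarrow> Fraction_Field.Fract w u \<in> quotients V"
  by (simp add: polynomial_quotients_def eq_fract(1)[THEN iffD2, of 1 u b "b * u"] mult_ac)

text \<open>Exact quotients stay because inverses of nonzero quotients are again quotients. A constant
\<open>c\<close> occurs as the quotient of \<open>c u\<close> by \<open>u\<close>.\<close>

lemma saturated_polynomial_quotients:
  assumes add: "\<And>x y. x \<in> quotients V \<Longrightarrow> y \<in> quotients V \<Longrightarrow> x + y \<in> quotients V"
    and mult: "\<And>x y. x \<in> quotients V \<Longrightarrow> y \<in> quotients V \<Longrightarrow> x * y \<in> quotients V"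
  shows "saturated_subalgebra polynomial_quotients"
proof
  fix c :: 'a
  obtain u where u: "u \<in> V" "u \<noteq> 0" by (rule nonzero_element)
  have "Fraction_Field.Fract (smult c u) u \<in> quotients V"
    using u pvec.subspace_scale[OF subspace] by (intro quotientsI)
  then show "[:c:] \<in> polynomial_quotients" using u(2) by (simp add: polynomial_quotients_iff[of u "smult c u"])
next
  fix p q assume pq: "p \<in> polynomial_quotients" "q \<in> polynomial_quotients"
  have "Fraction_Field.Fract p 1 + Fraction_Field.Fract q 1 \<in> quotients V"
    using pq add by (simp only: polynomial_quotients_def mem_Collect_eq)
  then show "p + q \<in> polynomial_quotients" by (simp add: polynomial_quotients_def)
  have "Fraction_Field.Fract p 1 * Fraction_Field.Fract q 1 \<in> quotients V"
    using pq mult by (simp only: polynomial_quotients_def mem_Collect_eq)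
  then show "p * q \<in> polynomial_quotients" by (simp add: polynomial_quotients_def)
next
  fix b h assume bh: "b * h \<in> polynomial_quotients" "b \<in> polynomial_quotients" "b \<noteq> 0"
  from bh(2) obtain w u where wu: "Fraction_Field.Fract b 1 = Fraction_Field.Fract w u"
    "w \<in> V" "u \<in> V" "u \<noteq> 0"
    by (auto simp: polynomial_quotients_def quotients_def)
  then have "w = b * u" by (simp add: eq_fract)
  then have "w \<noteq> 0" using bh(3) wu(4) by simp
  then have "Fraction_Field.Fract u w \<in> quotients V" using wu by (intro quotientsI)
  then have "Fraction_Field.Fract (b * h) 1 * Fraction_Field.Fract u w \<in> quotients V"
    using bh(1) mult by (simp only: polynomial_quotients_def mem_Collect_eq)
  also have "Fraction_Field.Fract (b * h) 1 * Fraction_Field.Fract u w = Fraction_Field.Fract h 1"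
    using \<open>w \<noteq> 0\<close> wu(4) bh(3) unfolding \<open>w = b * u\<close> by (simp add: eq_fract)
  finally show "h \<in> polynomial_quotients" by (simp add: polynomial_quotients_def)
qed

text \<open>An infinite-dimensional \<open>V\<close> contains infinitely many independent multiples of one of its
nonzero elements \<open>u\<close>, which cannot all be scalar multiples of \<open>u\<close>.\<close>

lemma polynomial_quotients_nonconst:
  obtains b where "b \<in> polynomial_quotients" "degree b > 0"
proof -
  obtain u where u: "u \<in> V" "u \<noteq> 0" by (rule nonzero_element)
  have inf: "\<not> pvec.fin_dim (V \<inter> range ((*) u))"
    by (rule not_fin_dim_Int_multiples[OF subspace infinite u(2)])
  have "\<exists>b. u * b \<in> V \<and> degree b > 0"
  proof (rule ccontr)
    assume "\<not> ?thesis"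
    then have "V \<inter> range ((*) u) \<subseteq> {p. degree p \<le> degree u}"
      using u(2) by (auto simp: degree_mult_eq intro: order_trans[OF degree_mult_le])
    moreover have "pvec.fin_dim {p :: 'a poly. degree p \<le> degree u}"
      by (rule bounded_degree_fin_dim[OF bounded_degree_subspace]) auto
    moreover have "pvec.subspace (V \<inter> range ((*) u))"
      by (rule pvec.subspace_inter[OF subspace subspace_multiples])
    ultimately show False using inf bounded_degree_fin_dim[of "V \<inter> range ((*) u)" "degree u"] by blast
  qed
  then obtain b where b: "u * b \<in> V" "degree b > 0" by blast
  have "b \<in> polynomial_quotients"
    using polynomial_quotients_iff[of u "u * b" b] u b by (simp add: quotientsI mult.commute)
  then show ?thesis using that b(2) by blast
qed

text \<open>With \<open>B = \<bbbk>[f]\<close> the polynomial quotients, a quotient \<open>w / u\<close> lies in \<open>\<bbbk>(f)\<close> because \<open>w b\<close>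
is a multiple of \<open>u\<close> for some nonzero \<open>b \<in> B\<close>: the space \<open>w B\<close> is infinite-dimensional. The
cofactor \<open>h\<close> with \<open>w b = u h\<close> is again in \<open>B\<close>. The last claim is the source of the inclusion of
a Lie algebra in \<open>L(f)\<close>.\<close>

theorem quotients_eq_adjoin:
  assumes add: "\<And>x y. x \<in> quotients V \<Longrightarrow> y \<in> quotients V \<Longrightarrow> x + y \<in> quotients V"
    and mult: "\<And>x y. x \<in> quotients V \<Longrightarrow> y \<in> quotients V \<Longrightarrow> x * y \<in> quotients V"
  obtains f where "degree f > 0" "quotients V = adjoin f"
    "\<And>v. v \<in> V \<Longrightarrow> pderiv f * v \<in> poly_subalg f"
proof -
  interpret B: saturated_subalgebra polynomial_quotients
    using saturated_polynomial_quotients[OF add mult] .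
  obtain b where "b \<in> polynomial_quotients" "degree b > 0" by (rule polynomial_quotients_nonconst)
  then obtain f where f: "degree f > 0" "polynomial_quotients = range (\<lambda>p. pcompose p f)"
    by (rule B.polynomial_lueroth)
  have int: "p \<in> polynomial_quotients \<longleftrightarrow> p \<in> poly_subalg f" for p by (simp add: f(2) poly_subalg_def)
  have "[:0, 1:] \<circ>\<^sub>p f = f" by (simp add: pcompose_pCons)
  then have fint: "f \<in> polynomial_quotients" unfolding int poly_subalg_def by (metis rangeI)
  then obtain w u where wu: "Fraction_Field.Fract f 1 = Fraction_Field.Fract w u"
    "w \<in> V" "u \<in> V" "u \<noteq> 0"
    by (auto simp: polynomial_quotients_def quotients_def)
  then have w: "w = f * u" by (simp add: eq_fract)
  \<comment> \<open>The bracket of \<open>u \<partial>\<close> and \<open>f u \<partial>\<close> is \<open>f' u\<^sup>2 \<partial>\<close>.\<close>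
  have "u * pderiv w - pderiv u * w \<in> V" using wu by (intro wronskian)
  also have "u * pderiv w - pderiv u * w = pderiv f * u * u"
    by (simp add: w pderiv_mult algebra_simps)
  finally have D: "pderiv f * u * u \<in> V" .
  have deriv: "pderiv f * v \<in> poly_subalg f" if v: "v \<in> V" for v
  proof -
    have "Fraction_Field.Fract (pderiv f * u * u) u * Fraction_Field.Fract v u \<in> quotients V"
      using D v wu by (intro mult quotientsI)
    also have "Fraction_Field.Fract (pderiv f * u * u) u * Fraction_Field.Fract v u
        = Fraction_Field.Fract (pderiv f * v) 1"
      using wu(4) by (simp add: eq_fract)
    finally show ?thesis by (simp add: polynomial_quotients_def flip: int)
  qed
  have "quotients V \<subseteq> adjoin f"
  proof
    fix x assume x: "x \<in> quotients V"
    then obtain w u where wu: "x = Fraction_Field.Fract w u"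
      "w \<in> V" "u \<in> V" "u \<noteq> 0"
      by (auto simp: quotients_def)
    have "\<exists>b h. b \<in> polynomial_quotients \<and> b \<noteq> 0 \<and> w * b = u * h"
    proof (cases "w = 0")
      case True
      then show ?thesis using B.const[of 1] by (intro exI[of _ "[:1:]"] exI[of _ 0]) simp
    next
      case False
      interpret T: Vector_Spaces.linear smult smult "(*) w"
        by (simp add: Vector_Spaces.linear_iff smult_vector_space distrib_left)
      have inj: "inj ((*) w)" using False by (simp add: inj_def)
      have Bsub: "pvec.subspace polynomial_quotients"
        using B.mult[OF B.const] by (intro pvec_subspaceI B.zero B.add) force+
      have "\<not> pvec.fin_dim polynomial_quotients"
      proof
        assume "pvec.fin_dim polynomial_quotients"
        then obtain n where n: "\<And>w. w \<in> polynomial_quotients \<Longrightarrow> degree w \<le> n"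
          by (rule fin_dim_bounded_degree) auto
        have "monom 1 (Suc n) \<circ>\<^sub>p f \<in> polynomial_quotients" unfolding f(2) by simp
        from n[OF this] have "Suc n * degree f \<le> n" by (simp add: degree_pcompose degree_monom_eq)
        moreover have "Suc n * 1 \<le> Suc n * degree f" using f(1) by (intro mult_le_mono2) simp
        ultimately show False by simp
      qed
      then have "\<not> pvec.fin_dim ((*) w ` polynomial_quotients)"
        using T.fin_dim_inj_image_iff[OF inj] by blast
      then have "\<not> pvec.fin_dim ((*) w ` polynomial_quotients \<inter> range ((*) u))"
        by (intro not_fin_dim_Int_multiples T.subspace_image Bsub wu(4))
      then obtain y where "y \<in> (*) w ` polynomial_quotients \<inter> range ((*) u)" "y \<noteq> 0"
        by (rule pvec.not_fin_dim_nonzero)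
          (intro pvec.subspace_inter T.subspace_image Bsub subspace_multiples)
      then show ?thesis by auto
    qed
    then obtain b h where bh: "b \<in> polynomial_quotients" "b \<noteq> 0" "w * b = u * h" by blast
    have "Fraction_Field.Fract w u * Fraction_Field.Fract b 1 \<in> quotients V"
      using x bh(1) unfolding wu(1) by (intro mult) (simp_all add: polynomial_quotients_def)
    also have "Fraction_Field.Fract w u * Fraction_Field.Fract b 1 = Fraction_Field.Fract h 1"
      using bh(3) wu(4) by (simp add: eq_fract mult.commute)
    finally have "h \<in> polynomial_quotients" by (simp add: polynomial_quotients_def)
    then obtain p q where pq: "h = p \<circ>\<^sub>p f" "b = q \<circ>\<^sub>p f" using bh(1) f(2) by blast
    have "x = Fraction_Field.Fract (p \<circ>\<^sub>p f) (q \<circ>\<^sub>p f)"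
      using bh wu pq by (simp add: eq_fract mult.commute)
    then show "x \<in> adjoin f" using bh(2) pq(2) unfolding adjoin_eq by blast
  qed
  moreover have "adjoin f \<subseteq> quotients V"
  proof
    fix x assume "x \<in> adjoin f"
    then obtain p q where x: "x = Fraction_Field.Fract (p \<circ>\<^sub>p f) (q \<circ>\<^sub>p f)" "q \<circ>\<^sub>p f \<noteq> 0"
      unfolding adjoin_eq by blast
    have "q \<circ>\<^sub>p f \<in> polynomial_quotients" unfolding f(2) by simp
    then obtain w u where wu: "Fraction_Field.Fract (q \<circ>\<^sub>p f) 1 = Fraction_Field.Fract w u"
      "w \<in> V" "u \<in> V" "u \<noteq> 0"
      by (auto simp: polynomial_quotients_def quotients_def)
    then have w: "w = (q \<circ>\<^sub>p f) * u" by (simp add: eq_fract)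
    have "Fraction_Field.Fract (p \<circ>\<^sub>p f) 1 * Fraction_Field.Fract u w \<in> quotients V"
    proof (intro mult)
      have "p \<circ>\<^sub>p f \<in> polynomial_quotients" unfolding f(2) by simp
      then show "Fraction_Field.Fract (p \<circ>\<^sub>p f) 1 \<in> quotients V" by (simp add: polynomial_quotients_def)
      show "Fraction_Field.Fract u w \<in> quotients V" using wu x(2) w by (intro quotientsI) auto
    qed
    also have "Fraction_Field.Fract (p \<circ>\<^sub>p f) 1 * Fraction_Field.Fract u w = x"
      using x(2) wu(4) w by (simp add: x(1) eq_fract)
    finally show "x \<in> quotients V" .
  qed
  ultimately have "quotients V = adjoin f" by blast
  then show ?thesis using that f(1) deriv by blast
qed

end

section \<open>Degrees in a space closed under Wronskians\<close>

text \<open>Adding a large member to two consecutive ones gives members \<open>m\<close> and \<open>m + 1\<close> with \<open>m \<ge> 2\<close>.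
The numbers \<open>r (m + 1) + m\<close> with \<open>1 \<le> r \<le> m\<close> represent all residues modulo \<open>m\<close>. They are reached
by adding \<open>m + 1\<close> repeatedly to \<open>m\<close>, and \<open>m\<close> can then be added to them any number of times; at
each addition the two summands are distinct.\<close>

lemma cofinite_of_distinct_sums:
  fixes E :: "int set"
  assumes sum: "\<And>x y. x \<in> E \<Longrightarrow> y \<in> E \<Longrightarrow> x \<noteq> y \<Longrightarrow> x + y \<in> E"
    and unbounded: "\<And>n. \<exists>e\<in>E. e > n"
    and a: "a \<in> E" "a + 1 \<in> E"
  obtains N where "\<And>n. n \<ge> N \<Longrightarrow> n \<in> E"
proof -
  obtain s where s: "s \<in> E" "s > \<bar>a\<bar> + 2" using unbounded by blast
  define m where "m = a + s"
  have m: "m \<in> E" "m + 1 \<in> E" "m \<ge> 2"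
    using sum[OF a(1) s(1)] sum[OF a(2) s(1)] s(2) by (auto simp: m_def algebra_simps)
  \<comment> \<open>The factor starts at 1 because \<open>m + m\<close> is not a sum of two distinct members, while \<open>(m +
    1) + m\<close> is.\<close>
  define e where "e r = (1 + int r) * (m + 1) + m" for r
  have e_Suc: "e (Suc r) = e r + (m + 1)" for r by (simp add: e_def algebra_simps)
  have e_gt: "e r > m + 1" for r
    by (induction r) (use m(3) in \<open>simp_all add: e_Suc\<close>, simp add: e_def)
  have e: "e r \<in> E" for r
  proof (induction r)
    case 0
    show ?case using sum[OF m(2,1)] by (simp add: e_def)
  next
    case (Suc r)
    have "e r \<noteq> m + 1" using e_gt[of r] by simp
    from sum[OF Suc m(2) this] show ?case unfolding e_Suc .
  qed
  have ek: "e r + int k * m \<in> E" for r k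
  proof (induction k)
    case 0
    show ?case using e by simp
  next
    case (Suc k)
    have "int k * m \<ge> 0" using m(3) by simp
    then have "e r + int k * m \<noteq> m" using e_gt[of r] by linarith
    from sum[OF Suc m(1) this] show ?case by (simp add: algebra_simps)
  qed
  have "n \<in> E" if n: "n \<ge> m * (m + 1) + m" for n
  proof -
    define r where "r = nat ((n - 1) mod m)"
    define k where "k = (n - 1) div m - int r - 2"
    have r: "int r = (n - 1) mod m" "int r < m" using m(3) by (simp_all add: r_def)
    have "n - 1 = m * ((n - 1) div m) + int r" unfolding r(1) by simp
    then have eq: "n = e r + k * m" by (simp add: e_def k_def algebra_simps)
    have "(1 + int r) * (m + 1) \<le> m * (m + 1)" using r(2) m(3) by (intro mult_right_mono) auto
    then have "e r \<le> n" using n by (simp add: e_def)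
    then have "k * m \<ge> 0" using eq by linarith
    then have "k \<ge> 0" using m(3) by (simp add: zero_le_mult_iff)
    then show ?thesis using ek[of r "nat k"] eq by simp
  qed
  then show ?thesis using that by blast
qed

lemma coeff_mult_pderiv:
  fixes p q :: "'a::field_char_0 poly"
  assumes "degree p + degree q = Suc n"
  shows "coeff (p * pderiv q) n = of_nat (degree q) * lead_coeff p * lead_coeff q"
    and "degree (p * pderiv q) \<le> n"
proof -
  consider "degree q = 0" | m where "degree q = Suc m" by (cases "degree q") auto
  then have "coeff (p * pderiv q) n = of_nat (degree q) * lead_coeff p * lead_coeff q
      \<and> degree (p * pderiv q) \<le> n"
  proof cases
    case 1
    then show ?thesis by (simp add: pderiv_eq_0_iff[THEN iffD2])
  next
    case 2
    then have n: "n = degree p + degree (pderiv q)" using assms by (simp add: degree_pderiv)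
    have "coeff (pderiv q) (degree (pderiv q)) = of_nat (degree q) * lead_coeff q"
      using 2 by (simp add: degree_pderiv coeff_pderiv)
    then show ?thesis unfolding n coeff_mult_degree_sum by (simp add: degree_mult_le)
  qed
  then show "coeff (p * pderiv q) n = of_nat (degree q) * lead_coeff p * lead_coeff q"
    and "degree (p * pderiv q) \<le> n" by blast+
qed

text \<open>The leading terms of \<open>p * q'\<close> and \<open>p' * q\<close> carry the factors \<open>degree q\<close> and \<open>degree p\<close>,
which stay different in a field of characteristic zero.\<close>

lemma degree_wronskian:
  fixes p q :: "'a::field_char_0 poly"
  assumes "p \<noteq> 0" "q \<noteq> 0" "degree p \<noteq> degree q"
  shows "p * pderiv q - pderiv p * q \<noteq> 0"
    and "Suc (degree (p * pderiv q - pderiv p * q)) = degree p + degree q"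
proof -
  obtain n where n: "degree p + degree q = Suc n" using assms(3) by (cases "degree p + degree q") auto
  then have n': "degree q + degree p = Suc n" by simp
  let ?w = "p * pderiv q - pderiv p * q"
  have "coeff ?w n = (of_nat (degree q) - of_nat (degree p)) * (lead_coeff p * lead_coeff q)"
    using coeff_mult_pderiv(1)[OF n] coeff_mult_pderiv(1)[OF n'] by (simp add: algebra_simps)
  then have c: "coeff ?w n \<noteq> 0" using assms by simp
  have "degree ?w \<le> n"
    using coeff_mult_pderiv(2)[OF n] coeff_mult_pderiv(2)[OF n']
    by (intro degree_diff_le) (simp_all add: mult.commute)
  with c have "degree ?w = n" by (intro antisym le_degree)
  then show "Suc (degree ?w) = degree p + degree q" using n by simp
  show "?w \<noteq> 0" using c by auto
qed

text \<open>The shift by \<open>degree h - 1\<close> makes the degree additive under the operation \<open>h (p q' - p'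
q)\<close>. It can be \<open>-1\<close>, so the shifted degrees are taken in the integers.\<close>

lemma cofinite_degrees:
  fixes P :: "'a::field_char_0 poly set"
  assumes P: "pvec.subspace P" "\<not> pvec.fin_dim P" and "h \<noteq> 0"
    and closed: "\<And>p q. p \<in> P \<Longrightarrow> q \<in> P \<Longrightarrow> h * (p * pderiv q - pderiv p * q) \<in> P"
    and q: "q \<in> P" "[:0, 1:] * q \<in> P" "q \<noteq> 0"
  obtains N where "\<And>n. n \<ge> N \<Longrightarrow> \<exists>p\<in>P. p \<noteq> 0 \<and> degree p = n"
proof -
  define E where "E = (\<lambda>p. int (degree p) + int (degree h) - 1) ` (P - {0})"
  have sum: "x + y \<in> E" if xy: "x \<in> E" "y \<in> E" "x \<noteq> y" for x y
  proof -
    from xy(1) obtain p where p: "p \<in> P" "p \<noteq> 0" "x = int (degree p) + int (degree h) - 1"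
      by (auto simp: E_def)
    from xy(2) obtain r where r: "r \<in> P" "r \<noteq> 0" "y = int (degree r) + int (degree h) - 1"
      by (auto simp: E_def)
    let ?w = "p * pderiv r - pderiv p * r"
    have w: "?w \<noteq> 0" "Suc (degree ?w) = degree p + degree r"
      using degree_wronskian[of p r] p r xy(3) by auto
    have "h * ?w \<in> P" "h * ?w \<noteq> 0" using closed p r w assms(3) by auto
    moreover have "x + y = int (degree (h * ?w)) + int (degree h) - 1"
      using w assms(3) p(3) r(3) by (simp add: degree_mult_eq)
    ultimately show ?thesis unfolding E_def by blast
  qed
  have unbounded: "\<exists>e\<in>E. e > n" for n
  proof -
    obtain p where p: "p \<in> P" "degree p > nat (n + 1)"
      using bounded_degree_fin_dim[OF P(1), of "nat (n + 1)"] P(2) not_le by blast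
    then have "p \<noteq> 0" by auto
    moreover have "int (degree p) + int (degree h) - 1 > n" using p(2) by linarith
    ultimately show ?thesis using p(1) unfolding E_def by blast
  qed
  have a: "int (degree q) + int (degree h) - 1 \<in> E" using q by (auto simp: E_def)
  have "[:0, 1:] * q \<in> P - {0}" using q by simp
  then have "int (degree ([:0, 1:] * q)) + int (degree h) - 1 \<in> E" unfolding E_def by (rule imageI)
  moreover have "degree ([:0, 1:] * q) = Suc (degree q)" using q(3) by (simp add: degree_mult_eq)
  ultimately have "(int (degree q) + int (degree h) - 1) + 1 \<in> E" by simp
  from cofinite_of_distinct_sums[OF sum unbounded a this]
  obtain N where N: "\<And>n. n \<ge> N \<Longrightarrow> n \<in> E" by blast
  have "\<exists>p\<in>P. p \<noteq> 0 \<and> degree p = n" if "n \<ge> nat (N + 1)" for n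
  proof -
    have "int n + int (degree h) - 1 \<in> E" by (rule N) (use that in linarith)
    then show ?thesis by (auto simp: E_def)
  qed
  then show ?thesis using that by blast
qed

text \<open>Elements of \<open>P\<close> remove the leading term of any polynomial of degree above \<open>N\<close>, and the
polynomials of degree at most \<open>N\<close> are spanned by a finite set.\<close>

lemma finite_codim_of_cofinite_degrees:
  fixes P :: "'a::field poly set"
  assumes P: "\<And>n. n \<ge> N \<Longrightarrow> \<exists>p\<in>P. p \<noteq> 0 \<and> degree p = n"
  obtains B where "finite B" "pvec.span (P \<union> B) = UNIV"
proof -
  have "pvec.fin_dim {p :: 'a poly. degree p \<le> N}"
    by (rule bounded_degree_fin_dim[OF bounded_degree_subspace]) auto
  then obtain B where B: "finite B" "pvec.span B = {p :: 'a poly. degree p \<le> N}"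
    by (auto simp: pvec.fin_dim_def)
  have "p \<in> pvec.span (P \<union> B)" for p
  proof (induction "degree p" arbitrary: p rule: less_induct)
    case less
    show ?case
    proof (cases "degree p \<le> N")
      case True
      then have "p \<in> pvec.span B" using B(2) by simp
      then show ?thesis using pvec.span_mono[of B "P \<union> B"] by auto
    next
      case False
      then obtain r where r: "r \<in> P" "r \<noteq> 0" "degree r = degree p" using P[of "degree p"] by auto
      define s where "s = p - smult (lead_coeff p / lead_coeff r) r"
      have "degree s \<le> degree p"
        unfolding s_def using r(3) by (intro degree_diff_le) (auto intro: order_trans[OF degree_smult_le])
      moreover have "coeff s (degree p) = 0" using r by (simp add: s_def flip: r(3))
      ultimately have "degree s < degree p"
        using False by (metis degree_0 le_neq_implies_less leading_coeff_0_iff le0)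
      then have "s \<in> pvec.span (P \<union> B)" by (rule less.hyps)
      moreover have "r \<in> pvec.span (P \<union> B)" using r by (intro pvec.span_base) auto
      moreover have "p = s + smult (lead_coeff p / lead_coeff r) r" by (simp add: s_def)
      ultimately show ?thesis by (metis pvec.span_add pvec.span_scale)
    qed
  qed
  then show ?thesis using that B(1) by blast
qed

section \<open>Lie subalgebras and the algebras attached to polynomials\<close>

text \<open>The products \<open>f' v\<close> that lie in \<open>\<bbbk>[f]\<close> form an ideal of the principal ideal domain \<open>\<bbbk>[f]\<close>,
generated by its nonzero member of least degree.\<close>

lemma g_min_generates:
  fixes f :: "'a::field poly"
  assumes f: "degree f > 0" and u: "u \<noteq> 0" "pderiv f * u \<in> poly_subalg f" and "pderiv f \<noteq> 0"
  shows "g_min f \<noteq> 0" and "pderiv f * g_min f \<in> poly_subalg f"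
    and "\<And>v. pderiv f * v \<in> poly_subalg f \<Longrightarrow> \<exists>q. v = (q \<circ>\<^sub>p f) * g_min f"
proof -
  define g where "g = g_min f"
  have g: "g \<noteq> 0" "pderiv f * g \<in> poly_subalg f"
    and min: "\<And>v. v \<noteq> 0 \<Longrightarrow> pderiv f * v \<in> poly_subalg f \<Longrightarrow> degree g \<le> degree v"
    using arg_min_nat_lemma[of "\<lambda>g. g \<noteq> 0 \<and> pderiv f * g \<in> poly_subalg f" u degree] u
    by (auto simp: g_def g_min_def)
  show "g_min f \<noteq> 0" "pderiv f * g_min f \<in> poly_subalg f" using g by (simp_all add: g_def)
  show "\<exists>q. v = (q \<circ>\<^sub>p f) * g_min f" if v: "pderiv f * v \<in> poly_subalg f" for v
  proof -
    from g(2) obtain h where h: "pderiv f * g = h \<circ>\<^sub>p f" by (auto simp: poly_subalg_def)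
    from v obtain p where p: "pderiv f * v = p \<circ>\<^sub>p f" by (auto simp: poly_subalg_def)
    define q where "q = p div h"
    define r where "r = p mod h"
    define y where "y = v - (q \<circ>\<^sub>p f) * g"
    have h0: "h \<noteq> 0" using h g(1) assms(4) by auto
    have "p = q * h + r" by (simp add: q_def r_def)
    then have "p \<circ>\<^sub>p f = (q \<circ>\<^sub>p f) * (h \<circ>\<^sub>p f) + r \<circ>\<^sub>p f"
      by (metis pcompose_add pcompose_mult)
    then have y: "pderiv f * y = r \<circ>\<^sub>p f"
      by (simp add: y_def right_diff_distrib p flip: h)
    have "y = 0"
    proof (rule ccontr)
      assume y0: "y \<noteq> 0"
      then have r0: "r \<noteq> 0" using y assms(4) by auto
      have "degree g \<le> degree y" using min[OF y0] y by (auto simp: poly_subalg_def)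
      then have "degree (pderiv f * g) \<le> degree (pderiv f * y)"
        using g(1) y0 assms(4) by (simp add: degree_mult_eq)
      then have "degree h * degree f \<le> degree r * degree f" by (simp add: h y degree_pcompose)
      then have "degree h \<le> degree r" using f by simp
      moreover have "degree r < degree h" unfolding r_def using degree_mod_less'[OF h0] r0 r_def by simp
      ultimately show False by simp
    qed
    then show ?thesis by (auto simp: y_def g_def)
  qed
qed

text \<open>For non-constant \<open>f\<close> and \<open>g = g_min f\<close> this map identifies the polynomial ring with \<open>L_alg
f\<close>, and it carries questions of dimension and codimension from spaces of operators to spaces of
polynomials.\<close>

lemma linear_vfield_pcompose:
  "Vector_Spaces.linear smult endo_scale (\<lambda>q. ((q \<circ>\<^sub>p f) * g) \<partial>)"
  by (simp add: Vector_Spaces.linear_iff smult_vector_space endo.vector_space_axioms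
      vfield_def endo_scale_def fun_eq_iff pcompose_add pcompose_smult algebra_simps)

lemma inj_vfield_pcompose:
  fixes f g :: "'a::field poly"
  assumes "degree f > 0" "g \<noteq> 0"
  shows "inj (\<lambda>q. ((q \<circ>\<^sub>p f) * g) \<partial>)"
proof (rule injI)
  fix p q assume "((p \<circ>\<^sub>p f) * g) \<partial> = ((q \<circ>\<^sub>p f) * g) \<partial>"
  then have "(p - q) \<circ>\<^sub>p f = 0" using assms(2) by (simp add: vfield_inject pcompose_diff)
  then show "p = q" using pcompose_eq_0[of "p - q" f] assms(1) by simp
qed

lemma infinite_dimensional_iff: "infinite_dimensional W \<longleftrightarrow> \<not> endo.fin_dim W"
  by (simp add: infinite_dimensional_def endo.fin_dim_def)

lemma wronskian_closed_coefficients: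
  fixes \<gg> :: "('a::field_char_0 poly \<Rightarrow> 'a poly) set"
  assumes "lie_subalgebra \<gg>" "infinite_dimensional \<gg>"
  shows "wronskian_closed {w. w \<partial> \<in> \<gg>}"
proof
  have lin: "Vector_Spaces.linear smult endo_scale (vfield :: 'a poly \<Rightarrow> _)"
    using linear_vfield_pcompose[of "[:0, 1:]" 1] by simp
  interpret T: Vector_Spaces.linear smult endo_scale "vfield :: 'a poly \<Rightarrow> _" by (rule lin)
  show "pvec.subspace {w. w \<partial> \<in> \<gg>}"
    using T.subspace_vimage[of \<gg>] assms(1) by (simp add: lie_subalgebra_def vimage_def)
  have "\<gg> = vfield ` {w. w \<partial> \<in> \<gg>}"
    using assms(1) by (auto simp: lie_subalgebra_def derivation_iff)
  moreover have "inj (vfield :: 'a poly \<Rightarrow> _)" by (simp add: inj_def vfield_inject)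
  ultimately show "\<not> pvec.fin_dim {w. w \<partial> \<in> \<gg>}"
    using assms(2) T.fin_dim_inj_image_iff by (metis infinite_dimensional_iff)
  show "v * pderiv w - pderiv v * w \<in> {w. w \<partial> \<in> \<gg>}"
    if "v \<in> {w. w \<partial> \<in> \<gg>}" "w \<in> {w. w \<partial> \<in> \<gg>}" for v w
    using assms(1) that by (force simp: lie_subalgebra_def simp flip: lie_bracket_vfield)
qed

lemma L_alg_eq_range: "L_alg f = range (\<lambda>q. ((q \<circ>\<^sub>p f) * g_min f) \<partial>)"
  by (auto simp: L_alg_def)

lemma ratios_of_finite_codim:
  assumes f: "degree f > 0" "g_min f \<noteq> 0"
    and \<gg>: "endo.subspace \<gg>" "\<gg> \<subseteq> L_alg f" "finite_codimension_in \<gg> (L_alg f)"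
  shows "ratios \<gg> = adjoin f"
proof -
  define T where "T q = ((q \<circ>\<^sub>p f) * g_min f) \<partial>" for q
  have lin: "Vector_Spaces.linear smult endo_scale T"
    unfolding T_def[abs_def] by (rule linear_vfield_pcompose)
  interpret T: Vector_Spaces.linear smult endo_scale T by (rule lin)
  have inj: "inj T" unfolding T_def[abs_def] by (rule inj_vfield_pcompose[OF f])
  have L: "L_alg f = range T" by (simp add: L_alg_eq_range T_def[abs_def])
  define P where "P = T -` \<gg>"
  have P: "pvec.subspace P" unfolding P_def by (rule T.subspace_vimage[OF \<gg>(1)])
  have \<gg>P: "\<gg> = T ` P" using \<gg>(2) by (auto simp: P_def L)
  from \<gg>(3) obtain C where C: "finite C" "C \<subseteq> range T" "endo.span (\<gg> \<union> C) = range T"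
    by (auto simp: finite_codimension_in_def L)
  then obtain B where B: "finite B" "C = T ` B" using finite_subset_image by metis
  have "T ` pvec.span (P \<union> B) = range T"
    using C(3) by (simp add: \<gg>P B(2) T.span_image flip: image_Un)
  then have span: "pvec.span (P \<union> B) = UNIV" using inj by (simp add: inj_image_eq_iff)
  have mem: "w \<partial> \<in> \<gg> \<longleftrightarrow> (\<exists>p\<in>P. w = (p \<circ>\<^sub>p f) * g_min f)" for w
    by (auto simp: \<gg>P T_def vfield_inject)
  have fract: "Fraction_Field.Fract ((p \<circ>\<^sub>p f) * e) ((q \<circ>\<^sub>p f) * e)
      = Fraction_Field.Fract (p \<circ>\<^sub>p f) (q \<circ>\<^sub>p f)"
    if "e \<noteq> 0" "q \<circ>\<^sub>p f \<noteq> 0" for p q e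
    using that by (simp add: eq_fract)
  show ?thesis
  proof
    show "ratios \<gg> \<subseteq> adjoin f"
      unfolding ratios_def mem adjoin_eq using fract[OF f(2)] by fastforce
    show "adjoin f \<subseteq> ratios \<gg>"
    proof
      fix x assume "x \<in> adjoin f"
      then obtain p q where x: "x = Fraction_Field.Fract (p \<circ>\<^sub>p f) (q \<circ>\<^sub>p f)" "q \<circ>\<^sub>p f \<noteq> 0"
        unfolding adjoin_eq by blast
      obtain c where c: "c \<noteq> 0" "p * c \<in> P" "q * c \<in> P"
        by (rule fractions_over_finite_codim[OF P B(1) span])
      have "c \<circ>\<^sub>p f \<noteq> 0" using pcompose_eq_0[of c f] f(1) c(1) by blast
      then have e: "(c \<circ>\<^sub>p f) * g_min f \<noteq> 0" using f(2) by simp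
      have "T (p * c) \<in> \<gg>" "T (q * c) \<in> \<gg>" using c by (simp_all add: P_def)
      then have "((p \<circ>\<^sub>p f) * ((c \<circ>\<^sub>p f) * g_min f)) \<partial> \<in> \<gg>" "((q \<circ>\<^sub>p f) * ((c \<circ>\<^sub>p f) * g_min f)) \<partial> \<in> \<gg>"
        by (simp_all add: T_def pcompose_mult mult.assoc)
      moreover have "(q \<circ>\<^sub>p f) * ((c \<circ>\<^sub>p f) * g_min f) \<noteq> 0" using e x(2) by simp
      ultimately show "x \<in> ratios \<gg>"
        unfolding ratios_def x(1) fract[OF e x(2), symmetric] by blast
    qed
  qed
qed

text \<open>In terms of polynomials \<open>p\<close> with \<open>(p(f) g) \<partial> \<in> \<gg>\<close>, the bracket becomes \<open>h (p q' - p' q)\<close>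
with \<open>h(f) = f' g\<close>, and \<open>f\<close> being a ratio means that \<open>q\<close> and \<open>x q\<close> occur for some \<open>q \<noteq> 0\<close>.\<close>

lemma finite_codim_of_ratios:
  fixes \<gg> :: "('a::field_char_0 poly \<Rightarrow> 'a poly) set"
  assumes \<gg>: "lie_subalgebra \<gg>" "infinite_dimensional \<gg>"
    and f: "degree f > 0" "Fraction_Field.Fract f 1 \<in> ratios \<gg>"
    and deriv: "\<And>v. v \<partial> \<in> \<gg> \<Longrightarrow> pderiv f * v \<in> poly_subalg f"
  shows "\<gg> \<subseteq> L_alg f" "finite_codimension_in \<gg> (L_alg f)"
proof -
  from f(2) obtain w u where wu: "Fraction_Field.Fract f 1 = Fraction_Field.Fract w u"
    "w \<partial> \<in> \<gg>" "u \<partial> \<in> \<gg>" "u \<noteq> 0"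
    by (auto simp: ratios_def)
  have w: "w = f * u" using wu by (simp add: eq_fract)
  have df: "pderiv f \<noteq> 0" using f(1) by (simp add: pderiv_eq_0_iff)
  define g where "g = g_min f"
  note gm = g_min_generates[OF f(1) wu(4) deriv[OF wu(3)] df, folded g_def]
  define T where "T q = ((q \<circ>\<^sub>p f) * g) \<partial>" for q
  have lin: "Vector_Spaces.linear smult endo_scale T"
    unfolding T_def[abs_def] by (rule linear_vfield_pcompose)
  interpret T: Vector_Spaces.linear smult endo_scale T by (rule lin)
  have inj: "inj T" unfolding T_def[abs_def] by (rule inj_vfield_pcompose[OF f(1) gm(1)])
  have L: "L_alg f = range T" by (simp add: L_alg_eq_range T_def[abs_def] g_def)
  show sub: "\<gg> \<subseteq> L_alg f"
  proof
    fix D assume D: "D \<in> \<gg>"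
    then obtain v where v: "D = v \<partial>" using \<gg>(1) by (auto simp: lie_subalgebra_def derivation_iff)
    then obtain q where "v = (q \<circ>\<^sub>p f) * g" using gm(3) deriv D by blast
    then show "D \<in> L_alg f" by (auto simp: L T_def v)
  qed
  define P where "P = T -` \<gg>"
  have P: "pvec.subspace P"
    unfolding P_def using \<gg>(1) by (intro T.subspace_vimage) (simp add: lie_subalgebra_def)
  have \<gg>P: "\<gg> = T ` P" using sub by (auto simp: P_def L)
  have infP: "\<not> pvec.fin_dim P"
    using \<gg>(2) T.fin_dim_inj_image_iff[OF inj] by (simp add: infinite_dimensional_iff \<gg>P)
  from gm(2) obtain h where h: "pderiv f * g = h \<circ>\<^sub>p f" by (auto simp: poly_subalg_def)
  have h0: "h \<noteq> 0" using h gm(1) df by auto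
  have closed: "h * (p * pderiv q - pderiv p * q) \<in> P" if pq: "p \<in> P" "q \<in> P" for p q
  proof -
    have "lie_bracket (T p) (T q) \<in> \<gg>" using pq \<gg>(1) by (auto simp: P_def lie_subalgebra_def)
    also have "lie_bracket (T p) (T q) =
        ((pderiv f * g) * ((p \<circ>\<^sub>p f) * (pderiv q \<circ>\<^sub>p f) - (pderiv p \<circ>\<^sub>p f) * (q \<circ>\<^sub>p f)) * g) \<partial>"
      unfolding T_def lie_bracket_vfield vfield_inject
      by (simp add: pderiv_mult pderiv_pcompose algebra_simps)
    also have "\<dots> = T (h * (p * pderiv q - pderiv p * q))"
      by (simp add: T_def h pcompose_mult pcompose_diff)
    finally show ?thesis by (simp add: P_def)
  qed
  obtain q where q: "u = (q \<circ>\<^sub>p f) * g" using gm(3) deriv wu(3) by blast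
  have "T q \<in> \<gg>" using wu(3) by (simp add: T_def q)
  moreover have "T ([:0, 1:] * q) \<in> \<gg>"
  proof -
    have "[:0, 1:] \<circ>\<^sub>p f = f" by (simp add: pcompose_pCons)
    then have "([:0, 1:] * q) \<circ>\<^sub>p f = f * (q \<circ>\<^sub>p f)" by (simp only: pcompose_mult)
    then show ?thesis using wu(2) by (simp only: T_def w q mult.assoc)
  qed
  moreover have "q \<noteq> 0" using q wu(4) by auto
  ultimately obtain N where "\<And>n. n \<ge> N \<Longrightarrow> \<exists>p\<in>P. p \<noteq> 0 \<and> degree p = n"
    using cofinite_degrees[OF P infP h0 closed, of q] by (auto simp: P_def)
  then obtain B where B: "finite B" "pvec.span (P \<union> B) = UNIV"
    by (rule finite_codim_of_cofinite_degrees)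
  have "endo.span (\<gg> \<union> T ` B) = T ` pvec.span (P \<union> B)"
    unfolding \<gg>P image_Un[symmetric] by (rule T.span_image)
  then show "finite_codimension_in \<gg> (L_alg f)"
    unfolding finite_codimension_in_def L using B by (intro exI[of _ "T ` B"]) auto
qed

theorem theorem0p6:
  fixes \<gg> :: "('a::field_char_0 poly \<Rightarrow> 'a poly) set"
  assumes "lie_subalgebra \<gg>" and "infinite_dimensional \<gg>"
  shows "((\<exists>f. degree f > 0 \<and> \<gg> \<subseteq> L_alg f \<and> finite_codimension_in \<gg> (L_alg f))
            \<longleftrightarrow> subfield (ratios \<gg>) ratfun_field)
       \<and> (subfield (ratios \<gg>) ratfun_field
            \<longleftrightarrow> (\<exists>f. f \<noteq> 0 \<and> ratios \<gg> = adjoin f))"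
proof -
  interpret V: wronskian_closed "{w. w \<partial> \<in> \<gg>}"
    using assms by (rule wronskian_closed_coefficients)
  have codim: "\<exists>f. degree f > 0 \<and> ratios \<gg> = adjoin f"
    if f: "degree f > 0" "\<gg> \<subseteq> L_alg f" "finite_codimension_in \<gg> (L_alg f)" for f
  proof -
    obtain u where u: "u \<partial> \<in> \<gg>" "u \<noteq> 0" using V.nonzero_element by auto
    have "g_min f \<noteq> 0"
    proof
      assume "g_min f = 0"
      then have "u \<partial> = 0 \<partial>" using u(1) f(2) by (auto simp: L_alg_def)
      then show False using u(2) by (simp add: vfield_inject)
    qed
    then show ?thesis
      using ratios_of_finite_codim f assms(1) by (metis lie_subalgebra_def)
  qed
  have field: "\<exists>f. degree f > 0 \<and> \<gg> \<subseteq> L_alg f \<and> finite_codimension_in \<gg> (L_alg f) \<and> ratios \<gg> = adjoin f"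
    if sub: "subfield (ratios \<gg>) ratfun_field"
  proof -
    obtain f where f: "degree f > 0" "quotients {w. w \<partial> \<in> \<gg>} = adjoin f"
      "\<And>v. v \<in> {w. w \<partial> \<in> \<gg>} \<Longrightarrow> pderiv f * v \<in> poly_subalg f"
      using V.quotients_eq_adjoin subfield_ratfunD[OF sub] unfolding ratios_eq_quotients by blast
    have "Fraction_Field.Fract f 1 \<in> adjoin f"
      unfolding adjoin_def by (rule generate_field.incl) simp
    then show ?thesis
      using finite_codim_of_ratios[OF assms f(1)] f by (auto simp: ratios_eq_quotients)
  qed
  show ?thesis
    using codim field subfield_adjoin by (metis degree_0 less_numeral_extra(3))
qed

end
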